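(* Let $\Gamma$ be a second-order differential equation field on $E=\mathbb R\times TM$, $\dim M=n$, whose matrix $\boldsymbol\Phi=(\Phi^a_b)$ is diagonalisable with distinct eigenvalues. Suppose that exactly $q\ge 1$ of the $n$ eigen co-distributions $D_a^\perp=\mathrm{Sp}\{\phi^{aV},\phi^{aH}\}$ are not (Frobenius) integrable. If none of the ideals $\langle\tilde\Sigma^1\rangle,\dots,\langle\tilde\Sigma^q\rangle$ is a differential ideal, then the inverse problem for $\Gamma$ has no non-degenerate solution, i.e. there is no closed 2-form $\omega\in\Sigma^0$ with $\wedge^n\omega\ne0$.
   Context: Everything is smooth and local (on a suitable open domain). $M$ is an $n$-manifold with coordinates $(x^a)$, $E=\mathbb R\times TM$ has coordinates $(t,x^a,u^a)$. For a system $\ddot x^a=F^a(t,x,\dot x)$ put $\Gamma=\partial_t+u^a\partial_{x^a}+F^a\partial_{u^a}$, $\Gamma^a_b=-\frac12\partial F^a/\partial u^b$, $\Phi^a_b=-\partial F^a/\partial x^b-\Gamma^c_b\Gamma^a_c-\Gamma(\Gamma^a_b)$, $V_a=\partial_{u^a}$, $H_a=\partial_{x^a}-\Gamma^b_a\partial_{u^b}$, $\theta^a=dx^a-u^adt$, $\psi^a=du^a-F^adt+\Gamma^a_b\theta^b$; $\{dt,\psi^a,\theta^a\}$ is dual to $\{\Gamma,V_a,H_a\}$. $\boldsymbol\Phi=(\Phi^a_b)$ diagonalisable: there is a local smooth frame of eigenvectors $X_a=X_a^b\partial_{x^b}$ (components functions on $E$) with $\Phi^c_bX_a^b=\lambda_aX_a^c$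 (no sum on $a$) and real eigenvalue functions $\lambda_a$; $\phi^a=\phi^a_b\theta^b$ is the dual frame ($\phi^a_cX^c_b=\delta^a_b$). Lifts: $X_a^V=X_a^bV_b$, $X_a^H=X_a^bH_b$, $\phi^{aV}=\phi^a_b\psi^b$, $\phi^{aH}=\phi^a_b\theta^b$, so $\{dt,\phi^{aV},\phi^{aH}\}$ is dual to $\{\Gamma,X_a^V,X_a^H\}$. The eigen co-distribution $D_a^\perp=\mathrm{Sp}\{\phi^{aV},\phi^{aH}\}$ is integrable if $d\phi^{aV}\equiv0\equiv d\phi^{aH}\pmod{\phi^{aV},\phi^{aH}}$. $\mathrm{Sp}$ denotes span over smooth functions. $\Sigma^0=\mathrm{Sp}\{\frac12(\phi^{aV}\wedge\phi^{bH}+\phi^{bV}\wedge\phi^{aH}):a\le b\}$. Closed maximal-rank ($\wedge^n\omega\neq 0$) elements of $\Sigma^0$ are the non-degenerate (regular) solutions of the inverse problem (they correspond to multiplier matrices, hence regular Lagrangians, for the system). $\omega^a=\phi^{aV}\wedge\phi^{aH}$ (no sum), $\tilde\Sigma^1=\mathrm{Sp}\{\omega^a:a=1,\dots,n\}$ and, for $i\ge1$, $\tilde\Sigma^{i+1}=\{\omega\in\tilde\Sigma^i: d\omega\in\langle\tilde\Sigma^i\rangle\}$, where $\langle\Sigma\rangle$ is the ideal generated by $\Sigma$ in the exterior algebra of forms on the domain; it is a differential ideal if it is closed under $d$. The submodules $\tilde\Sigma^i$ are treated as having constant rank (spaces of sections of subbundles), and $\dim$ means this rank. *)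

theory Defs
  imports "HOL-Analysis.Analysis"
begin

text \<open>
  Smooth functions and differential forms on an open subset \<open>U\<close> of a Euclidean space.
  Functions and forms are total; only their values on \<open>U\<close> are ever constrained, and all
  equations between them are required on \<open>U\<close> only.
\<close>

primrec Ck_on :: "nat \<Rightarrow> 'a::euclidean_space set \<Rightarrow> ('a \<Rightarrow> 'b::real_normed_vector) \<Rightarrow> bool" where
  "Ck_on 0 U f \<longleftrightarrow> continuous_on U f"
| "Ck_on (Suc k) U f \<longleftrightarrow> (\<forall>p\<in>U. f differentiable (at p)) \<and>
      (\<forall>v. Ck_on k U (\<lambda>p. frechet_derivative f (at p) v))"

definition smooth_on :: "'a::euclidean_space set \<Rightarrow> ('a \<Rightarrow> 'b::real_normed_vector) \<Rightarrow> bool" where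
  "smooth_on U f \<longleftrightarrow> (\<forall>k. Ck_on k U f)"

text \<open>
  A (possibly inhomogeneous) differential form: its degree \<open>k\<close> part at the point \<open>p\<close> is the
  restriction of \<open>\<omega> p\<close> to lists of \<open>k\<close> tangent vectors.  Since the tangent vectors are constant,
  smoothness of all the evaluations is smoothness of the coefficients.
\<close>

type_synonym 'a form = "'a \<Rightarrow> 'a list \<Rightarrow> real"

definition forms :: "'a::euclidean_space set \<Rightarrow> 'a form set" where
  "forms U = {\<omega>. (\<forall>vs. smooth_on U (\<lambda>p. \<omega> p vs)) \<and>
     (\<forall>p\<in>U. \<forall>vs. (\<forall>i<length vs. linear (\<lambda>v. \<omega> p (vs[i := v]))) \<and>
                  (\<not> distinct vs \<longrightarrow> \<omega> p vs = 0))}"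

definition one_form :: "('a \<Rightarrow> 'a \<Rightarrow> real) \<Rightarrow> 'a form" where
  "one_form \<alpha> p vs = (case vs of [v] \<Rightarrow> \<alpha> p v | _ \<Rightarrow> 0)"

text \<open>
  The exterior product as a sum over shuffles: \<open>S\<close> is the set of positions of the vectors that are
  fed to \<open>\<alpha>\<close>, and the exponent counts the inversions of the shuffle.  There are no
  normalising factorials, so \<open>(\<alpha> \<and> \<beta>)(v, w) = \<alpha>(v) \<beta>(w) - \<alpha>(w) \<beta>(v)\<close> for 1-forms.
\<close>

definition wedge :: "'a form \<Rightarrow> 'a form \<Rightarrow> 'a form" (infixr \<open>\<and>\<^sub>f\<close> 70) where
  "(\<alpha> \<and>\<^sub>f \<beta>) p vs = (\<Sum>S\<in>Pow {..<length vs}.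
      (-1) ^ card {(i, j). i \<in> S \<and> j \<in> {..<length vs} - S \<and> j < i}
      * \<alpha> p (nths vs S) * \<beta> p (nths vs ({..<length vs} - S)))"

primrec wedge_power :: "nat \<Rightarrow> 'a form \<Rightarrow> 'a form" where
  "wedge_power 0 \<omega> = (\<lambda>p vs. if vs = [] then 1 else 0)"
| "wedge_power (Suc k) \<omega> = \<omega> \<and>\<^sub>f wedge_power k \<omega>"

text \<open>
  The invariant formula for the exterior derivative, evaluated on constant vector fields (so that
  the bracket terms vanish).
\<close>

definition ext_deriv :: "'a::euclidean_space form \<Rightarrow> 'a form" where
  "ext_deriv \<omega> p vs = (\<Sum>i<length vs.
      (-1) ^ i * frechet_derivative (\<lambda>y. \<omega> y (take i vs @ drop (Suc i) vs)) (at p) (vs ! i))"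

definition closed_form :: "'a::euclidean_space set \<Rightarrow> 'a form \<Rightarrow> bool" where
  "closed_form U \<omega> \<longleftrightarrow> (\<forall>p\<in>U. \<forall>vs. ext_deriv \<omega> p vs = 0)"

definition Sp :: "'a::euclidean_space set \<Rightarrow> 'a form set \<Rightarrow> 'a form set" where
  "Sp U S = {\<omega>. \<exists>T c. finite T \<and> T \<subseteq> S \<and> (\<forall>\<tau>\<in>T. smooth_on U (c \<tau>)) \<and>
     (\<forall>p\<in>U. \<forall>vs. \<omega> p vs = (\<Sum>\<tau>\<in>T. c \<tau> p * \<tau> p vs))}"

text \<open>
  The ideal of the exterior algebra generated by a set \<open>S\<close> of homogeneous forms.  By graded
  commutativity the left multiples already make up a two-sided ideal.
\<close>

definition ideal_gen :: "'a::euclidean_space set \<Rightarrow> 'a form set \<Rightarrow> 'a form set" where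
  "ideal_gen U S = {\<omega>. \<exists>T \<beta>. finite T \<and> T \<subseteq> S \<and> (\<forall>\<sigma>\<in>T. \<beta> \<sigma> \<in> forms U) \<and>
     (\<forall>p\<in>U. \<forall>vs. \<omega> p vs = (\<Sum>\<sigma>\<in>T. (\<beta> \<sigma> \<and>\<^sub>f \<sigma>) p vs))}"

definition differential_ideal :: "'a::euclidean_space form set \<Rightarrow> bool" where
  "differential_ideal I \<longleftrightarrow> (\<forall>\<omega>\<in>I. ext_deriv \<omega> \<in> I)"

text \<open>
  \<open>S\<close> is the space of all sections over \<open>U\<close> of a rank \<open>r\<close> subbundle \<open>W\<close> of the exterior algebra
  bundle: near every point of \<open>U\<close> the fibres of \<open>W\<close> have a smooth frame of \<open>r\<close> forms.  The frame
  is taken from \<open>S\<close>, which is no restriction, since local sections near a point can be cut off and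
  extended to all of \<open>U\<close>.
\<close>

definition sections_of_subbundle :: "'a::euclidean_space set \<Rightarrow> nat \<Rightarrow> 'a form set \<Rightarrow> bool" where
  "sections_of_subbundle U r S \<longleftrightarrow> (\<exists>W :: 'a \<Rightarrow> ('a list \<Rightarrow> real) set.
     (\<forall>p\<in>U. \<exists>N e. open N \<and> p \<in> N \<and> N \<subseteq> U \<and> (\<forall>i<r. e i \<in> S) \<and>
        (\<forall>y\<in>N. (\<forall>c :: nat \<Rightarrow> real. (\<forall>vs. (\<Sum>i<r. c i * e i y vs) = 0) \<longrightarrow> (\<forall>i<r. c i = 0)) \<and>
                W y = {(\<lambda>vs. \<Sum>i<r. c i * e i y vs) | c. True})) \<and>
     S = {\<omega> \<in> forms U. \<forall>p\<in>U. \<omega> p \<in> W p})"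

text \<open>
  The geometry of a system of second-order equations.  A point of the evolution space is
  \<open>(t, x, u)\<close>, and the index type \<open>'n\<close> has \<open>n\<close> elements.
\<close>

type_synonym 'n evol = "real \<times> (real ^ 'n) \<times> (real ^ 'n)"

definition sode :: "('n::finite evol \<Rightarrow> real ^ 'n) \<Rightarrow> 'n evol \<Rightarrow> 'n evol" where
  "sode F = (\<lambda>(t, x, u). (1, u, F (t, x, u)))"

definition conn :: "('n::finite evol \<Rightarrow> real ^ 'n) \<Rightarrow> 'n evol \<Rightarrow> real ^ 'n ^ 'n" where
  "conn F p = (\<chi> a b. - (1/2) * frechet_derivative (\<lambda>y. F y $ a) (at p) (0, 0, axis b 1))"

definition Phi :: "('n::finite evol \<Rightarrow> real ^ 'n) \<Rightarrow> 'n evol \<Rightarrow> real ^ 'n ^ 'n" where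
  "Phi F p = (\<chi> a b. - frechet_derivative (\<lambda>y. F y $ a) (at p) (0, axis b 1, 0)
      - (\<Sum>c\<in>UNIV. conn F p $ c $ b * conn F p $ a $ c)
      - frechet_derivative (\<lambda>y. conn F y $ a $ b) (at p) (sode F p))"

definition theta :: "'n::finite \<Rightarrow> 'n evol \<Rightarrow> 'n evol \<Rightarrow> real" where
  "theta a = (\<lambda>(t, x, u) (dt, dx, du). dx $ a - u $ a * dt)"

definition psi :: "('n::finite evol \<Rightarrow> real ^ 'n) \<Rightarrow> 'n \<Rightarrow> 'n evol \<Rightarrow> 'n evol \<Rightarrow> real" where
  "psi F a = (\<lambda>p (dt, dx, du). du $ a - F p $ a * dt
      + (\<Sum>b\<in>UNIV. conn F p $ a $ b * theta b p (dt, dx, du)))"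

text \<open>\<open>X a p $ b\<close> is the component \<open>X\<^sub>a\<^sup>b\<close>, and \<open>\<phi> a p $ b\<close> is the component \<open>\<phi>\<^sup>a\<^sub>b\<close>.\<close>

definition smooth_frame :: "'n::finite evol set \<Rightarrow> ('n \<Rightarrow> 'n evol \<Rightarrow> real ^ 'n) \<Rightarrow> bool" where
  "smooth_frame U X \<longleftrightarrow> (\<forall>a. smooth_on U (X a)) \<and>
     (\<forall>p\<in>U. inj (\<lambda>a. X a p) \<and> independent (range (\<lambda>a. X a p)))"

definition eigenframe :: "('n::finite evol \<Rightarrow> real ^ 'n) \<Rightarrow> 'n evol set \<Rightarrow>
    ('n \<Rightarrow> 'n evol \<Rightarrow> real ^ 'n) \<Rightarrow> ('n \<Rightarrow> 'n evol \<Rightarrow> real) \<Rightarrow> bool" where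
  "eigenframe F U X ev \<longleftrightarrow> smooth_frame U X \<and>
     (\<forall>p\<in>U. \<forall>a. Phi F p *v X a p = ev a p *\<^sub>R X a p)"

text \<open>Smoothness of \<open>\<phi>\<close> follows from that of \<open>X\<close>; it is only recorded here.\<close>

definition dual_frame :: "'n::finite evol set \<Rightarrow> ('n \<Rightarrow> 'n evol \<Rightarrow> real ^ 'n) \<Rightarrow>
    ('n \<Rightarrow> 'n evol \<Rightarrow> real ^ 'n) \<Rightarrow> bool" where
  "dual_frame U X \<phi> \<longleftrightarrow> (\<forall>a. smooth_on U (\<phi> a)) \<and>
     (\<forall>p\<in>U. \<forall>a b. (\<Sum>c\<in>UNIV. \<phi> a p $ c * X b p $ c) = (if a = b then 1 else 0))"

definition phiV :: "('n::finite evol \<Rightarrow> real ^ 'n) \<Rightarrow> ('n \<Rightarrow> 'n evol \<Rightarrow> real ^ 'n) \<Rightarrow> 'n \<Rightarrow> 'n evol form" where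
  "phiV F \<phi> a = one_form (\<lambda>p v. \<Sum>b\<in>UNIV. \<phi> a p $ b * psi F b p v)"

definition phiH :: "('n::finite \<Rightarrow> 'n evol \<Rightarrow> real ^ 'n) \<Rightarrow> 'n \<Rightarrow> 'n evol form" where
  "phiH \<phi> a = one_form (\<lambda>p v. \<Sum>b\<in>UNIV. \<phi> a p $ b * theta b p v)"

definition codist_integrable :: "('n::finite evol \<Rightarrow> real ^ 'n) \<Rightarrow> 'n evol set \<Rightarrow>
    ('n \<Rightarrow> 'n evol \<Rightarrow> real ^ 'n) \<Rightarrow> 'n \<Rightarrow> bool" where
  "codist_integrable F U \<phi> a \<longleftrightarrow>
     ext_deriv (phiV F \<phi> a) \<in> ideal_gen U {phiV F \<phi> a, phiH \<phi> a} \<and>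
     ext_deriv (phiH \<phi> a) \<in> ideal_gen U {phiV F \<phi> a, phiH \<phi> a}"

text \<open>
  The generators are symmetric in \<open>a\<close> and \<open>b\<close>, so letting \<open>(a, b)\<close> range over all pairs gives the
  same set of generators as \<open>a \<le> b\<close> for any ordering of the indices.
\<close>

definition Sigma0 :: "('n::finite evol \<Rightarrow> real ^ 'n) \<Rightarrow> 'n evol set \<Rightarrow>
    ('n \<Rightarrow> 'n evol \<Rightarrow> real ^ 'n) \<Rightarrow> 'n evol form set" where
  "Sigma0 F U \<phi> = Sp U {(\<lambda>p vs. 1/2 * ((phiV F \<phi> a \<and>\<^sub>f phiH \<phi> b) p vs
                                       + (phiV F \<phi> b \<and>\<^sub>f phiH \<phi> a) p vs)) | a b. True}"

text \<open>The sequence is indexed from 1; the index 0 is not used.\<close>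

definition Sigma_tilde :: "('n::finite evol \<Rightarrow> real ^ 'n) \<Rightarrow> 'n evol set \<Rightarrow>
    ('n \<Rightarrow> 'n evol \<Rightarrow> real ^ 'n) \<Rightarrow> nat \<Rightarrow> 'n evol form set" where
  "Sigma_tilde F U \<phi> i =
     ((\<lambda>S. {\<omega> \<in> S. ext_deriv \<omega> \<in> ideal_gen U S}) ^^ (i - 1))
       (Sp U (range (\<lambda>a. phiV F \<phi> a \<and>\<^sub>f phiH \<phi> a)))"

text \<open>Maximal rank on all of \<open>U\<close>: the top power vanishes nowhere.\<close>

definition maximal_rank :: "'n::finite evol set \<Rightarrow> 'n evol form \<Rightarrow> bool" where
  "maximal_rank U \<omega> \<longleftrightarrow> (\<forall>p\<in>U. \<exists>vs. wedge_power CARD('n) \<omega> p vs \<noteq> 0)"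

end

theory Submission
  imports Defs
begin

text \<open>
  Suppose that \<open>\<omega>\<close> is a closed element of \<open>\<Sigma>\<^sup>0\<close> of maximal rank, and write
  \<open>\<omega>\<^sup>a = \<phi>\<^sup>a\<^sup>V \<and> \<phi>\<^sup>a\<^sup>H\<close> (the form \<open>diag_form a\<close> below).  The contradiction comes from
  counting dimensions in the descending sequence of the \<open>\<Sigma>\<close>-tilde modules, written \<open>Sig i\<close> below.

  First, \<open>\<omega>\<close> is diagonal.  Evaluating \<open>d\<omega>\<close> on \<open>\<Gamma>\<close> and two horizontal lifts \<open>X\<^sub>e\<^sup>H\<close>, \<open>X\<^sub>f\<^sup>H\<close> leaves only
  \<open>d\<psi>\<^sup>a(\<Gamma>, X\<^sub>e\<^sup>H) = - \<Phi>\<^sup>a\<^sub>b X\<^sub>e\<^sup>b\<close>, so closedness says \<open>(\<lambda>\<^sub>f - \<lambda>\<^sub>e) \<omega>(X\<^sub>e\<^sup>V, X\<^sub>f\<^sup>H) = 0\<close>, the algebraic Helmholtz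
  condition that \<open>\<Phi>\<close> is symmetric for the multiplier.  As the eigenvalues are distinct,
  \<open>\<omega> = \<Sum> g\<^sub>a \<omega>\<^sup>a\<close> (lemmas \<open>ext_deriv_psi\<close>, \<open>closed_Sigma0_diagonal\<close>).  Maximal rank forces every \<open>g\<^sub>a\<close> to
  be nonzero everywhere, because the \<open>n\<close>-th power of a sum of fewer than \<open>n\<close> decomposable two-forms
  is zero (lemma \<open>maximal_rank_coeff_nonzero\<close>).

  Secondly, the sequence must retain many elements.  Being closed, \<open>\<omega>\<close> lies in every \<open>Sig i\<close>.  If
  \<open>D\<^sub>a\<^sup>\<bottom>\<close> is integrable, then \<open>d\<omega>\<^sup>a\<close> is a multiple of \<open>\<omega>\<^sup>a\<close>, so \<open>\<omega>\<^sup>a\<close> lies in every \<open>Sig i\<close> as well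
  (lemma \<open>integrable_in_Sig\<close>).  These are \<open>n - q\<close> of the \<open>\<omega>\<^sup>a\<close>, and \<open>\<omega>\<close> is independent of them since it
  has a nonzero coefficient at one of the \<open>q \<ge> 1\<close> remaining indices.  Hence \<open>Sig (q + 1)\<close> has rank at
  least \<open>n - q + 1\<close>.

  Thirdly, the sequence must lose rank.  If \<open>Sig (i + 1) = Sig i\<close>, then the derivatives of all
  generators of the ideal of \<open>Sig i\<close> lie in that ideal, and by the Leibniz rule the ideal is
  differential (lemma \<open>differential_ideal_gen\<close>).  A submodule of sections of a subbundle with the same
  rank is the whole module (lemma \<open>sections_rank_mono\<close>).  So each of the \<open>q\<close> steps from \<open>Sig 1\<close>, of
  rank at most \<open>n\<close>, lowers the rank, and \<open>Sig (q + 1)\<close> has rank at most \<open>n - q\<close>.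

  The exterior calculus used here is obtained from two recursions on the list of arguments, which are
  the Leibniz rule for the interior product (lemma \<open>wedge_Cons\<close>) and Cartan's formula for a constant
  vector field (lemma \<open>ext_deriv_Cons\<close>).
\<close>

section \<open>Smooth functions\<close>

lemma has_derivative_cong_open:
  assumes "open U" "p \<in> U" "\<And>y. y \<in> U \<Longrightarrow> f y = g y"
  shows "(f has_derivative D) (at p) \<longleftrightarrow> (g has_derivative D) (at p)"
proof
  show "(g has_derivative D) (at p)" if "(f has_derivative D) (at p)"
    by (rule has_derivative_transform_within_open[OF that assms(1,2)]) (rule assms(3))
  show "(f has_derivative D) (at p)" if "(g has_derivative D) (at p)"
    by (rule has_derivative_transform_within_open[OF that assms(1,2)]) (rule assms(3)[symmetric])
qed

lemma frechet_derivative_cong_open: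
  assumes "open U" "p \<in> U" "\<And>y. y \<in> U \<Longrightarrow> f y = g y"
  shows "frechet_derivative f (at p) = frechet_derivative g (at p)"
  using has_derivative_cong_open[where f = f and g = g, OF assms] by (simp add: frechet_derivative_def)

lemma Ck_on_cong:
  assumes "open U" "\<And>p. p \<in> U \<Longrightarrow> f p = g p"
  shows "Ck_on k U f \<longleftrightarrow> Ck_on k U g"
  using assms(2)
proof (induction k arbitrary: f g)
  case 0
  then show ?case by (simp cong: continuous_on_cong)
next
  case (Suc k)
  have 1: "f differentiable (at p) \<longleftrightarrow> g differentiable (at p)" if "p \<in> U" for p
    using has_derivative_cong_open[where f = f and g = g, OF assms(1) that Suc.prems] by (simp add: differentiable_def)
  have 2: "Ck_on k U (\<lambda>p. frechet_derivative f (at p) v) \<longleftrightarrow> Ck_on k U (\<lambda>p. frechet_derivative g (at p) v)" for v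
    by (rule Suc.IH) (simp add: frechet_derivative_cong_open[OF assms(1) _ Suc.prems])
  show ?case
    using 1 by (simp add: 2)
qed

lemma Ck_on_continuous: "Ck_on k U f \<Longrightarrow> continuous_on U f"
  by (cases k) (auto intro: continuous_at_imp_continuous_on differentiable_imp_continuous_within)

lemma Ck_on_Suc_imp: "Ck_on (Suc k) U f \<Longrightarrow> Ck_on k U f"
proof (induction k arbitrary: f)
  case 0
  then show ?case using Ck_on_continuous by fastforce
next
  case (Suc k)
  from Suc.prems have 1: "\<forall>p\<in>U. f differentiable (at p)"
    and 2: "\<And>v. Ck_on (Suc k) U (\<lambda>p. frechet_derivative f (at p) v)"
    unfolding Ck_on.simps(2)[of "Suc k" U f] by blast+
  show ?case using 1 Suc.IH[OF 2] by simp
qed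

lemma smooth_on_differentiable: "smooth_on U f \<Longrightarrow> p \<in> U \<Longrightarrow> f differentiable (at p)"
  by (auto simp: smooth_on_def dest!: spec[of _ "Suc 0"])

lemma smooth_on_derivative: "smooth_on U f \<Longrightarrow> smooth_on U (\<lambda>p. frechet_derivative f (at p) v)"
  unfolding smooth_on_def using Ck_on.simps(2) by blast

lemma Ck_on_const: "Ck_on k U (\<lambda>_. c)"
  by (induction k arbitrary: c) auto

lemma smooth_on_const: "smooth_on U (\<lambda>_. c)"
  by (simp add: smooth_on_def Ck_on_const)

lemma Ck_on_add:
  assumes "open U"
  shows "Ck_on k U f \<Longrightarrow> Ck_on k U g \<Longrightarrow> Ck_on k U (\<lambda>p. f p + g p)"
proof (induction k arbitrary: f g)
  case 0
  then show ?case by (simp add: continuous_on_add)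
next
  case (Suc k)
  have fd: "frechet_derivative (\<lambda>p. f p + g p) (at p) v
      = frechet_derivative f (at p) v + frechet_derivative g (at p) v" if "p \<in> U" for p v
  proof -
    have "f differentiable at p" "g differentiable at p"
      using Suc.prems that by simp_all
    then have "((\<lambda>p. f p + g p) has_derivative
        (\<lambda>v. frechet_derivative f (at p) v + frechet_derivative g (at p) v)) (at p)"
      by (intro has_derivative_add) (simp_all add: frechet_derivative_works[symmetric])
    then show ?thesis by (simp add: frechet_derivative_at[symmetric])
  qed
  have "Ck_on k U (\<lambda>p. frechet_derivative (\<lambda>p. f p + g p) (at p) v)" for v
    by (subst Ck_on_cong[OF \<open>open U\<close> fd]) (use Suc in auto)
  then show ?case using Suc.prems by simp
qed

lemma smooth_on_add: "open U \<Longrightarrow> smooth_on U f \<Longrightarrow> smooth_on U g \<Longrightarrow> smooth_on U (\<lambda>p. f p + g p)"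
  by (simp add: smooth_on_def Ck_on_add)

lemma Ck_on_mult:
  fixes f g :: "'a::euclidean_space \<Rightarrow> real"
  assumes "open U"
  shows "Ck_on k U f \<Longrightarrow> Ck_on k U g \<Longrightarrow> Ck_on k U (\<lambda>p. f p * g p)"
proof (induction k arbitrary: f g)
  case 0
  then show ?case by (simp add: continuous_on_mult)
next
  case (Suc k)
  have fd: "frechet_derivative (\<lambda>p. f p * g p) (at p) v
      = f p * frechet_derivative g (at p) v + frechet_derivative f (at p) v * g p" if "p \<in> U" for p v
  proof -
    have "f differentiable at p" "g differentiable at p"
      using Suc.prems that by simp_all
    then have "((\<lambda>p. f p * g p) has_derivative
        (\<lambda>v. f p * frechet_derivative g (at p) v + frechet_derivative f (at p) v * g p)) (at p)"
      by (intro has_derivative_mult) (simp_all add: frechet_derivative_works[symmetric])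
    then show ?thesis by (simp add: frechet_derivative_at[symmetric])
  qed
  have ck: "Ck_on k U f" "Ck_on k U g"
    using Suc.prems Ck_on_Suc_imp by blast+
  have "Ck_on k U (\<lambda>p. frechet_derivative (\<lambda>p. f p * g p) (at p) v)" for v
    by (subst Ck_on_cong[OF \<open>open U\<close> fd]) (use Suc ck in \<open>auto intro!: Ck_on_add[OF \<open>open U\<close>]\<close>)
  then show ?case using Suc.prems by simp
qed

lemma smooth_on_mult:
  fixes f g :: "'a::euclidean_space \<Rightarrow> real"
  shows "open U \<Longrightarrow> smooth_on U f \<Longrightarrow> smooth_on U g \<Longrightarrow> smooth_on U (\<lambda>p. f p * g p)"
  by (simp add: smooth_on_def Ck_on_mult)

lemma smooth_on_sum:
  assumes "open U" "\<And>i. i \<in> I \<Longrightarrow> smooth_on U (f i)"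
  shows "smooth_on U (\<lambda>p. \<Sum>i\<in>I. f i p)"
  using assms(2) by (induction I rule: infinite_finite_induct) (auto simp: smooth_on_const smooth_on_add \<open>open U\<close>)

lemma smooth_on_diff:
  fixes f g :: "'a::euclidean_space \<Rightarrow> real"
  assumes "open U" "smooth_on U f" "smooth_on U g"
  shows "smooth_on U (\<lambda>p. f p - g p)"
  using smooth_on_add[OF assms(1,2) smooth_on_mult[OF assms(1) smooth_on_const assms(3), of "-1"]] by simp

lemma Ck_on_bounded_linear:
  assumes "open U" "bounded_linear h"
  shows "Ck_on k U f \<Longrightarrow> Ck_on k U (\<lambda>p. h (f p))"
proof (induction k arbitrary: f)
  case 0
  then show ?case by (simp add: bounded_linear.continuous_on[OF assms(2)])
next
  case (Suc k)
  have d: "((\<lambda>p. h (f p)) has_derivative (\<lambda>v. h (frechet_derivative f (at p) v))) (at p)" if "p \<in> U" for p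
    using Suc.prems that
    by (intro bounded_linear.has_derivative[OF assms(2)]) (simp add: frechet_derivative_works[symmetric])
  have fd: "frechet_derivative (\<lambda>p. h (f p)) (at p) v = h (frechet_derivative f (at p) v)" if "p \<in> U" for p v
    using that by (simp add: frechet_derivative_at[OF d, symmetric])
  have "Ck_on k U (\<lambda>p. frechet_derivative (\<lambda>p. h (f p)) (at p) v)" for v
    by (subst Ck_on_cong[OF \<open>open U\<close> fd]) (use Suc in auto)
  then show ?case using d by (auto simp: differentiable_def)
qed

lemma smooth_on_bounded_linear:
  "open U \<Longrightarrow> bounded_linear h \<Longrightarrow> smooth_on U f \<Longrightarrow> smooth_on U (\<lambda>p. h (f p))"
  by (simp add: smooth_on_def Ck_on_bounded_linear)

lemma Ck_on_ident: "Ck_on k U (\<lambda>p. p)"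
  by (cases k) (auto simp: Ck_on_const frechet_derivative_ident)

lemma smooth_on_linear: "open U \<Longrightarrow> bounded_linear h \<Longrightarrow> smooth_on U h"
  using smooth_on_bounded_linear[of U h "\<lambda>p. p"] by (simp add: smooth_on_def Ck_on_ident)

section \<open>The exterior product\<close>

definition contract :: "'a \<Rightarrow> 'a form \<Rightarrow> 'a form" where
  "contract v \<omega> p vs = \<omega> p (v # vs)"

text \<open>
  The grading automorphism: forms may be inhomogeneous, so the sign \<open>(-1)\<^sup>k\<close> that a form of degree \<open>k\<close>
  contributes to a graded identity has to be carried by an operator.
\<close>

definition grade_sign :: "'a form \<Rightarrow> 'a form" where
  "grade_sign \<omega> p vs = (-1) ^ length vs * \<omega> p vs"

lemma wedge_Nil: "(\<alpha> \<and>\<^sub>f \<beta>) p [] = \<alpha> p [] * \<beta> p []"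
  by (simp add: wedge_def)

lemma nths_Suc_image: "nths (v # vs) (Suc ` S) = nths vs S"
  "nths (v # vs) (insert 0 (Suc ` S)) = v # nths vs S"
proof -
  have "{j. Suc j \<in> Suc ` S} = S" "{j. Suc j \<in> insert 0 (Suc ` S)} = S" by auto
  then show "nths (v # vs) (Suc ` S) = nths vs S"
  "nths (v # vs) (insert 0 (Suc ` S)) = v # nths vs S" by (auto simp: nths_Cons)
qed

text \<open>
  The interior product is a graded derivation of the exterior product.  A shuffle of \<open>v # vs\<close> arises
  from a shuffle of \<open>vs\<close> by giving \<open>v\<close> to one of the two factors; giving it to \<open>\<beta>\<close> adds one inversion for
  each vector that \<open>\<alpha>\<close> receives.  Together with the value on the empty list this determines the
  exterior product, and its algebraic laws follow by induction on the list of arguments.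
\<close>

lemma wedge_Cons:
  "(\<alpha> \<and>\<^sub>f \<beta>) p (v # vs) = (contract v \<alpha> \<and>\<^sub>f \<beta>) p vs + (grade_sign \<alpha> \<and>\<^sub>f contract v \<beta>) p vs"
proof -
  define n where "n = length vs"
  define inv where "inv m S = {(i, j). i \<in> S \<and> j \<in> {..<m::nat} - S \<and> j < i}" for m S
  define t where "t S = (-1) ^ card (inv (Suc n) S)
      * \<alpha> p (nths (v # vs) S) * \<beta> p (nths (v # vs) ({..<Suc n} - S))" for S
  have Pow_split: "Pow {..<Suc n} = (\<lambda>S. insert 0 (Suc ` S)) ` Pow {..<n} \<union> (\<lambda>S. Suc ` S) ` Pow {..<n}"
  proof -
    have "Pow (Suc ` {..<n}) = (`) Suc ` Pow {..<n}" by (simp add: image_Pow_surj)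
    then show ?thesis
      unfolding lessThan_Suc_eq_insert_0 Pow_insert by (simp add: image_image Un_commute)
  qed
  have inj0: "inj_on (\<lambda>S. insert 0 (Suc ` S)) (Pow {..<n})" 
  proof (rule inj_onI)
    fix S T assume "insert 0 (Suc ` S) = insert 0 (Suc ` T)"
    then have "Suc ` S = Suc ` T" by (simp add: insert_ident)
    then show "S = T" by (simp add: inj_image_eq_iff)
  qed
  have inj1: "inj_on (\<lambda>S. Suc ` S) (Pow {..<n})"
    by (simp add: inj_on_def inj_image_eq_iff)
  have inj_SS: "inj_on (map_prod Suc Suc) A" for A
    by (auto simp: inj_on_def)
  have inv0: "card (inv (Suc n) (insert 0 (Suc ` S))) = card (inv n S)" for S
  proof -
    have "inv (Suc n) (insert 0 (Suc ` S)) = map_prod Suc Suc ` inv n S"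
      by (auto simp: inv_def lessThan_Suc_eq_insert_0 map_prod_def image_iff)
    then show ?thesis
      by (simp add: card_image inj_SS)
  qed
  have inv1: "card (inv (Suc n) (Suc ` S)) = card S + card (inv n S)" if "S \<subseteq> {..<n}" for S
  proof -
    have fin: "finite S" using that finite_subset by blast
    have *: "inv (Suc n) (Suc ` S) = (\<lambda>i. (Suc i, 0)) ` S \<union> map_prod Suc Suc ` inv n S"
      by (auto simp: inv_def lessThan_Suc_eq_insert_0 map_prod_def image_iff)
    have "inv n S \<subseteq> S \<times> {..<n}" by (auto simp: inv_def)
    then have "finite (inv n S)" using fin finite_subset by blast
    then show ?thesis unfolding * using fin
      by (subst card_Un_disjoint) (auto simp: card_image inj_SS inj_on_def[of "\<lambda>i. (Suc i, 0)"])
  qed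
  have t0: "t (insert 0 (Suc ` S)) = (-1) ^ card (inv n S) * contract v \<alpha> p (nths vs S) * \<beta> p (nths vs ({..<n} - S))"
    if "S \<subseteq> {..<n}" for S
  proof -
    have "{..<Suc n} - insert 0 (Suc ` S) = Suc ` ({..<n} - S)"
      by (auto simp: lessThan_Suc_eq_insert_0)
    then show ?thesis by (simp add: t_def inv0 nths_Suc_image contract_def)
  qed
  have t1: "t (Suc ` S) = (-1) ^ card (inv n S) * grade_sign \<alpha> p (nths vs S) * contract v \<beta> p (nths vs ({..<n} - S))"
    if "S \<subseteq> {..<n}" for S
  proof -
    have "{..<Suc n} - Suc ` S = insert 0 (Suc ` ({..<n} - S))"
      by (auto simp: lessThan_Suc_eq_insert_0)
    moreover have "{i. i < n \<and> i \<in> S} = S" using that by auto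
    then have "length (nths vs S) = card S" by (simp add: length_nths n_def)
    ultimately show ?thesis
      using inv1[OF that] by (simp add: t_def nths_Suc_image contract_def grade_sign_def power_add)
  qed
  have "(\<alpha> \<and>\<^sub>f \<beta>) p (v # vs) = sum t (Pow {..<Suc n})"
    by (simp add: wedge_def t_def inv_def n_def)
  also have "\<dots> = sum t ((\<lambda>S. insert 0 (Suc ` S)) ` Pow {..<n}) + sum t ((\<lambda>S. Suc ` S) ` Pow {..<n})"
    unfolding Pow_split by (rule sum.union_disjoint) auto
  also have "\<dots> = (\<Sum>S\<in>Pow {..<n}. t (insert 0 (Suc ` S))) + (\<Sum>S\<in>Pow {..<n}. t (Suc ` S))"
    by (simp add: sum.reindex[OF inj0] sum.reindex[OF inj1])
  also have "(\<Sum>S\<in>Pow {..<n}. t (insert 0 (Suc ` S))) = (contract v \<alpha> \<and>\<^sub>f \<beta>) p vs"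
    by (simp add: t0 wedge_def inv_def n_def)
  also have "(\<Sum>S\<in>Pow {..<n}. t (Suc ` S)) = (grade_sign \<alpha> \<and>\<^sub>f contract v \<beta>) p vs"
    by (simp add: t1 wedge_def inv_def n_def)
  finally show ?thesis .
qed

definition scalar_form :: "('a \<Rightarrow> real) \<Rightarrow> 'a form" where
  "scalar_form f p vs = (if vs = [] then f p else 0)"

lemma wedge_local:
  "\<alpha> p = \<alpha>' p \<Longrightarrow> \<beta> p = \<beta>' p \<Longrightarrow> (\<alpha> \<and>\<^sub>f \<beta>) p = (\<alpha>' \<and>\<^sub>f \<beta>') p"
  by (simp add: wedge_def fun_eq_iff)

lemma wedge_sum_left:
  "((\<lambda>p vs. \<Sum>i\<in>I. c i p * \<alpha> i p vs) \<and>\<^sub>f \<beta>) p vs = (\<Sum>i\<in>I. c i p * (\<alpha> i \<and>\<^sub>f \<beta>) p vs)"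
  unfolding wedge_def sum_distrib_left sum_distrib_right
  by (subst sum.swap) (simp add: mult_ac)

lemma wedge_sum_right:
  "(\<alpha> \<and>\<^sub>f (\<lambda>p vs. \<Sum>i\<in>I. c i p * \<beta> i p vs)) p vs = (\<Sum>i\<in>I. c i p * (\<alpha> \<and>\<^sub>f \<beta> i) p vs)"
  unfolding wedge_def sum_distrib_left sum_distrib_right
  by (subst sum.swap) (simp add: mult_ac)

lemma wedge_add_left:
  "((\<lambda>p vs. \<alpha> p vs + \<alpha>' p vs) \<and>\<^sub>f \<beta>) p vs = (\<alpha> \<and>\<^sub>f \<beta>) p vs + (\<alpha>' \<and>\<^sub>f \<beta>) p vs"
  by (simp add: wedge_def sum.distrib[symmetric] algebra_simps)

lemma wedge_add_right:
  "(\<alpha> \<and>\<^sub>f (\<lambda>p vs. \<beta> p vs + \<beta>' p vs)) p vs = (\<alpha> \<and>\<^sub>f \<beta>) p vs + (\<alpha> \<and>\<^sub>f \<beta>') p vs"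
  by (simp add: wedge_def sum.distrib[symmetric] algebra_simps)

lemma wedge_diff_left:
  "((\<lambda>p vs. \<alpha> p vs - \<alpha>' p vs) \<and>\<^sub>f \<beta>) p vs = (\<alpha> \<and>\<^sub>f \<beta>) p vs - (\<alpha>' \<and>\<^sub>f \<beta>) p vs"
  by (simp add: wedge_def sum_subtractf[symmetric] algebra_simps)

lemma wedge_diff_right:
  "(\<alpha> \<and>\<^sub>f (\<lambda>p vs. \<beta> p vs - \<beta>' p vs)) p vs = (\<alpha> \<and>\<^sub>f \<beta>) p vs - (\<alpha> \<and>\<^sub>f \<beta>') p vs"
  by (simp add: wedge_def sum_subtractf[symmetric] algebra_simps)

lemma wedge_minus_left: "((\<lambda>p vs. - \<alpha> p vs) \<and>\<^sub>f \<beta>) p vs = - (\<alpha> \<and>\<^sub>f \<beta>) p vs"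
  by (simp add: wedge_def sum_negf)

lemma wedge_minus_right: "(\<alpha> \<and>\<^sub>f (\<lambda>p vs. - \<beta> p vs)) p vs = - (\<alpha> \<and>\<^sub>f \<beta>) p vs"
  by (simp add: wedge_def sum_negf)

lemma wedge_zero_left: "((\<lambda>p vs. 0) \<and>\<^sub>f \<beta>) p vs = 0"
  by (simp add: wedge_def)

lemma wedge_zero_right: "(\<alpha> \<and>\<^sub>f (\<lambda>p vs. 0)) p vs = 0"
  by (simp add: wedge_def)

lemmas wedge_linear = wedge_add_left wedge_add_right wedge_diff_left wedge_minus_left
  wedge_minus_right wedge_zero_left wedge_zero_right

lemma contract_wedge:
  "contract v (\<alpha> \<and>\<^sub>f \<beta>) = (\<lambda>p vs. (contract v \<alpha> \<and>\<^sub>f \<beta>) p vs + (grade_sign \<alpha> \<and>\<^sub>f contract v \<beta>) p vs)"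
  by (simp add: fun_eq_iff contract_def[of v "\<alpha> \<and>\<^sub>f \<beta>"] wedge_Cons)

lemma contract_grade_sign:
  "contract v (grade_sign \<alpha>) = (\<lambda>p vs. - grade_sign (contract v \<alpha>) p vs)"
  by (simp add: fun_eq_iff contract_def grade_sign_def)

lemma grade_sign_grade_sign: "grade_sign (grade_sign \<alpha>) = \<alpha>"
  by (simp add: fun_eq_iff grade_sign_def power_mult_distrib[symmetric] flip: mult.assoc)

lemma grade_sign_Nil: "grade_sign \<alpha> p [] = \<alpha> p []"
  by (simp add: grade_sign_def)

lemma grade_sign_Cons: "grade_sign \<alpha> p (v # vs) = - grade_sign (contract v \<alpha>) p vs"
  by (simp add: grade_sign_def contract_def)

lemma grade_sign_add: "grade_sign (\<lambda>p vs. \<alpha> p vs + \<beta> p vs) = (\<lambda>p vs. grade_sign \<alpha> p vs + grade_sign \<beta> p vs)"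
  by (simp add: fun_eq_iff grade_sign_def algebra_simps)

lemma grade_sign_wedge: "grade_sign (\<alpha> \<and>\<^sub>f \<beta>) = grade_sign \<alpha> \<and>\<^sub>f grade_sign \<beta>"
proof -
  have "grade_sign (\<alpha> \<and>\<^sub>f \<beta>) p vs = (grade_sign \<alpha> \<and>\<^sub>f grade_sign \<beta>) p vs" for p vs
  proof (induction vs arbitrary: \<alpha> \<beta>)
    case (Cons v vs)
    show ?case
      by (simp add: grade_sign_Cons[of "\<alpha> \<and>\<^sub>f \<beta>"] wedge_Cons contract_wedge contract_grade_sign
          grade_sign_add wedge_linear Cons.IH)
  qed (simp add: grade_sign_Nil wedge_Nil)
  then show ?thesis by (simp add: fun_eq_iff)
qed

lemma wedge_assoc: "(\<alpha> \<and>\<^sub>f \<beta>) \<and>\<^sub>f \<gamma> = \<alpha> \<and>\<^sub>f \<beta> \<and>\<^sub>f \<gamma>"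
proof -
  have "((\<alpha> \<and>\<^sub>f \<beta>) \<and>\<^sub>f \<gamma>) p vs = (\<alpha> \<and>\<^sub>f \<beta> \<and>\<^sub>f \<gamma>) p vs" for p vs
  proof (induction vs arbitrary: \<alpha> \<beta> \<gamma>)
    case (Cons v vs)
    show ?case
      by (simp add: wedge_Cons contract_wedge grade_sign_wedge wedge_linear Cons.IH)
  qed (simp add: wedge_Nil)
  then show ?thesis by (simp add: fun_eq_iff)
qed

lemma scalar_form_wedge: "(scalar_form f \<and>\<^sub>f \<beta>) p vs = f p * \<beta> p vs"
proof (induction vs arbitrary: \<beta>)
  case (Cons v vs)
  have "contract v (scalar_form f) = (\<lambda>p vs. 0)" "grade_sign (scalar_form f) = scalar_form f"
    by (auto simp: fun_eq_iff contract_def grade_sign_def scalar_form_def)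
  then show ?case
    by (simp add: wedge_Cons wedge_linear Cons.IH) (simp add: contract_def)
qed (simp add: wedge_Nil scalar_form_def)

lemma wedge_scalar_form: "(\<beta> \<and>\<^sub>f scalar_form f) p vs = f p * \<beta> p vs"
proof (induction vs arbitrary: \<beta>)
  case (Cons v vs)
  have "contract v (scalar_form f) = (\<lambda>p vs. 0)"
    by (auto simp: fun_eq_iff contract_def scalar_form_def)
  then show ?case
    by (simp add: wedge_Cons wedge_linear Cons.IH) (simp add: contract_def)
qed (simp add: wedge_Nil scalar_form_def)

lemma contract_one_form: "contract v (one_form a) = scalar_form (\<lambda>p. a p v)"
  by (auto simp: fun_eq_iff contract_def one_form_def scalar_form_def split: list.split)

lemma grade_sign_one_form: "grade_sign (one_form a) = (\<lambda>p vs. - one_form a p vs)"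
  by (auto simp: fun_eq_iff grade_sign_def one_form_def split: list.split)

text \<open>
  Graded commutativity with a factor of degree one: contracting both sides with \<open>v\<close> leaves the scalar \<open>a(v)\<close> times \<open>\<beta>\<close> and a smaller instance.
\<close>

lemma one_form_wedge_commute: "one_form a \<and>\<^sub>f \<beta> = grade_sign \<beta> \<and>\<^sub>f one_form a"
proof -
  have "(one_form a \<and>\<^sub>f \<beta>) p vs = (grade_sign \<beta> \<and>\<^sub>f one_form a) p vs" for p vs
  proof (induction vs arbitrary: \<beta>)
    case Nil
    show ?case by (simp add: wedge_Nil one_form_def)
  next
    case (Cons v vs)
    show ?case
      by (simp add: wedge_Cons contract_one_form grade_sign_one_form contract_grade_sign wedge_linear
          grade_sign_grade_sign scalar_form_wedge wedge_scalar_form Cons.IH)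
  qed
  then show ?thesis by (simp add: fun_eq_iff)
qed

lemma one_form_wedge_self: "one_form a \<and>\<^sub>f one_form a = (\<lambda>p vs. 0)"
proof -
  have "(one_form a \<and>\<^sub>f one_form a) p vs = - (one_form a \<and>\<^sub>f one_form a) p vs" for p vs
    using one_form_wedge_commute[of a "one_form a"] by (simp add: grade_sign_one_form wedge_linear fun_eq_iff)
  then show ?thesis by (simp add: fun_eq_iff)
qed

lemma one_form_eval: "one_form a p [] = 0" "one_form a p [v] = a p v" "one_form a p (v # w # vs) = 0"
  by (simp_all add: one_form_def)

lemma one_form_wedge_pair: "(one_form a \<and>\<^sub>f \<eta>) p [v, w] = a p v * \<eta> p [w] - a p w * \<eta> p [v]"
  by (simp add: wedge_Cons wedge_Nil contract_one_form grade_sign_one_form wedge_linear scalar_form_wedge)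
    (simp add: contract_def scalar_form_def grade_sign_def one_form_eval)

lemma one_form_wedge_triple:
  "(one_form a \<and>\<^sub>f \<eta>) p [v, w, x] = a p v * \<eta> p [w, x] - a p w * \<eta> p [v, x] + a p x * \<eta> p [v, w]"
  by (simp add: wedge_Cons wedge_Nil contract_one_form grade_sign_one_form wedge_linear scalar_form_wedge
      contract_grade_sign)
    (simp add: contract_def scalar_form_def grade_sign_def one_form_eval)

section \<open>Powers of sums of decomposable two-forms\<close>

lemma wedge_power_local: "\<omega> p = \<eta> p \<Longrightarrow> wedge_power k \<omega> p = wedge_power k \<eta> p"
  by (induction k) (auto intro: wedge_local)

text \<open>
  A central form of square zero annihilates every term of a power that contains it.
\<close>

lemma wedge_power_absorb:
  assumes central: "\<And>\<eta>. \<omega> \<and>\<^sub>f \<eta> = \<eta> \<and>\<^sub>f \<omega>" and square: "\<omega> \<and>\<^sub>f \<omega> = (\<lambda>p vs. 0)"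
  shows "\<omega> \<and>\<^sub>f wedge_power k (\<lambda>p vs. g p * \<omega> p vs + \<eta> p vs) = \<omega> \<and>\<^sub>f wedge_power k \<eta>"
proof (induction k)
  case (Suc k)
  let ?\<zeta> = "\<lambda>p vs. g p * \<omega> p vs + \<eta> p vs"
  have "(\<omega> \<and>\<^sub>f ?\<zeta>) p vs = (\<omega> \<and>\<^sub>f \<eta>) p vs" for p vs
    using wedge_sum_right[where I = "{()}" and c = "\<lambda>_. g" and \<beta> = "\<lambda>_. \<omega>"] by (simp add: wedge_add_right square)
  then have 1: "\<omega> \<and>\<^sub>f ?\<zeta> = \<omega> \<and>\<^sub>f \<eta>" by (simp add: fun_eq_iff)
  have "\<omega> \<and>\<^sub>f wedge_power (Suc k) ?\<zeta> = (\<omega> \<and>\<^sub>f ?\<zeta>) \<and>\<^sub>f wedge_power k ?\<zeta>"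
    by (simp add: wedge_assoc)
  also have "\<dots> = (\<eta> \<and>\<^sub>f \<omega>) \<and>\<^sub>f wedge_power k ?\<zeta>"
    by (simp only: 1) (simp only: central[of \<eta>])
  also have "\<dots> = (\<eta> \<and>\<^sub>f \<omega>) \<and>\<^sub>f wedge_power k \<eta>"
    by (simp only: wedge_assoc Suc.IH)
  also have "\<dots> = (\<omega> \<and>\<^sub>f \<eta>) \<and>\<^sub>f wedge_power k \<eta>"
    by (simp only: central[of \<eta>])
  finally show ?case by (simp add: wedge_assoc)
qed simp

text \<open>
  By expansion of the first factor, each term is \<open>\<omega>\<^sub>a\<close> times a power of the sum; by absorption \<open>\<omega>\<^sub>a\<close>
  may then be dropped from that sum, and the induction continues with one index and one factor
  fewer.  This avoids the multinomial expansion.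
\<close>

lemma wedge_power_eq_0:
  assumes "finite A" "card A < k"
    and central: "\<And>a \<eta>. \<omega> a \<and>\<^sub>f \<eta> = \<eta> \<and>\<^sub>f \<omega> a" and square: "\<And>a. \<omega> a \<and>\<^sub>f \<omega> a = (\<lambda>p vs. 0)"
  shows "wedge_power k (\<lambda>p vs. \<Sum>a\<in>A. g a p * \<omega> a p vs) p vs = 0"
  using assms(1,2)
proof (induction k arbitrary: A p vs)
  case (Suc k)
  let ?\<eta> = "\<lambda>p vs. \<Sum>a\<in>A. g a p * \<omega> a p vs"
  have "(\<omega> a \<and>\<^sub>f wedge_power k ?\<eta>) p vs = 0" if a: "a \<in> A" for a
  proof -
    let ?\<eta>' = "\<lambda>p vs. \<Sum>b\<in>A - {a}. g b p * \<omega> b p vs"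
    have "?\<eta> = (\<lambda>p vs. g a p * \<omega> a p vs + ?\<eta>' p vs)"
      using a Suc.prems(1) by (simp add: fun_eq_iff sum.remove)
    then have "\<omega> a \<and>\<^sub>f wedge_power k ?\<eta> = \<omega> a \<and>\<^sub>f wedge_power k ?\<eta>'"
      using wedge_power_absorb[OF central square] by simp
    moreover have "wedge_power k ?\<eta>' = (\<lambda>p vs. 0)"
    proof -
      have "card (A - {a}) < k" using card_Diff1_less[OF Suc.prems(1) a] Suc.prems(2) by linarith
      then show ?thesis using Suc.IH[of "A - {a}"] Suc.prems(1) by (simp add: fun_eq_iff)
    qed
    ultimately show ?thesis by (simp add: wedge_zero_right)
  qed
  then show ?case by (simp add: wedge_sum_left)
qed simp

lemma one_forms_wedge_central: "(one_form a \<and>\<^sub>f one_form b) \<and>\<^sub>f \<eta> = \<eta> \<and>\<^sub>f one_form a \<and>\<^sub>f one_form b"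
proof -
  have "(one_form a \<and>\<^sub>f one_form b) \<and>\<^sub>f \<eta> = one_form a \<and>\<^sub>f grade_sign \<eta> \<and>\<^sub>f one_form b"
    by (simp only: wedge_assoc one_form_wedge_commute[of b \<eta>])
  also have "\<dots> = (one_form a \<and>\<^sub>f grade_sign \<eta>) \<and>\<^sub>f one_form b" by (simp only: wedge_assoc)
  also have "\<dots> = (\<eta> \<and>\<^sub>f one_form a) \<and>\<^sub>f one_form b"
    by (simp only: one_form_wedge_commute[of a "grade_sign \<eta>"] grade_sign_grade_sign)
  finally show ?thesis by (simp only: wedge_assoc)
qed

lemma wedge_zero_form: "(\<lambda>p vs. 0) \<and>\<^sub>f \<beta> = (\<lambda>p vs. 0)" "\<alpha> \<and>\<^sub>f (\<lambda>p vs. 0) = (\<lambda>p vs. 0)"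
  by (simp_all add: fun_eq_iff wedge_zero_left wedge_zero_right)

lemma one_forms_wedge_square:
  "(one_form a \<and>\<^sub>f one_form b) \<and>\<^sub>f (one_form a \<and>\<^sub>f one_form b) = (\<lambda>p vs. 0)"
proof -
  have "(one_form a \<and>\<^sub>f one_form b) \<and>\<^sub>f (one_form a \<and>\<^sub>f one_form b)
      = ((one_form a \<and>\<^sub>f one_form b) \<and>\<^sub>f one_form a) \<and>\<^sub>f one_form b" by (simp only: wedge_assoc)
  also have "\<dots> = (one_form a \<and>\<^sub>f one_form a \<and>\<^sub>f one_form b) \<and>\<^sub>f one_form b"
    by (simp only: one_forms_wedge_central)
  also have "\<dots> = (one_form a \<and>\<^sub>f one_form a) \<and>\<^sub>f one_form b \<and>\<^sub>f one_form b" by (simp only: wedge_assoc)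
  finally show ?thesis by (simp only: one_form_wedge_self wedge_zero_form)
qed

section \<open>The exterior derivative\<close>

definition dir_deriv :: "'a::euclidean_space \<Rightarrow> 'a form \<Rightarrow> 'a form" where
  "dir_deriv v \<omega> p vs = frechet_derivative (\<lambda>y. \<omega> y vs) (at p) v"

lemma ext_deriv_Nil: "ext_deriv \<omega> p [] = 0"
  by (simp add: ext_deriv_def)

text \<open>
  Cartan's formula \<open>L\<^sub>v = \<iota>\<^sub>v d + d \<iota>\<^sub>v\<close> for a constant vector field \<open>v\<close>, where the Lie derivative is the
  directional derivative of the coefficients.
\<close>

lemma ext_deriv_Cons: "ext_deriv \<omega> p (v # vs) = dir_deriv v \<omega> p vs - ext_deriv (contract v \<omega>) p vs"
  by (simp add: ext_deriv_def dir_deriv_def contract_def lessThan_Suc_eq_insert_0 sum.reindex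
      zero_notin_Suc_image sum_negf)

definition differentiable_form :: "'a::euclidean_space \<Rightarrow> 'a form \<Rightarrow> bool" where
  "differentiable_form p \<omega> \<longleftrightarrow> (\<forall>vs. (\<lambda>y. \<omega> y vs) differentiable at p)"

lemma differentiable_form_dir: "differentiable_form p \<omega> \<Longrightarrow> ((\<lambda>y. \<omega> y vs) has_derivative (\<lambda>v. dir_deriv v \<omega> p vs)) (at p)"
  by (simp add: differentiable_form_def dir_deriv_def frechet_derivative_works[symmetric])

lemma dir_derivI: "((\<lambda>y. \<omega> y vs) has_derivative D) (at p) \<Longrightarrow> dir_deriv v \<omega> p vs = D v"
  by (simp add: dir_deriv_def frechet_derivative_at[symmetric])

lemma differentiable_form_contract: "differentiable_form p \<omega> \<Longrightarrow> differentiable_form p (contract v \<omega>)"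
  by (simp add: differentiable_form_def contract_def)

lemma dir_deriv_contract: "dir_deriv v (contract w \<omega>) = contract w (dir_deriv v \<omega>)"
  by (simp add: fun_eq_iff dir_deriv_def contract_def)

lemma has_derivative_grade_sign:
  assumes "differentiable_form p \<omega>"
  shows "((\<lambda>y. grade_sign \<omega> y vs) has_derivative (\<lambda>v. grade_sign (dir_deriv v \<omega>) p vs)) (at p)"
  unfolding grade_sign_def by (intro has_derivative_mult_right differentiable_form_dir assms)

lemma differentiable_form_grade_sign: "differentiable_form p \<omega> \<Longrightarrow> differentiable_form p (grade_sign \<omega>)"
  unfolding differentiable_form_def[of p "grade_sign \<omega>"]
  by (intro allI differentiableI) (rule has_derivative_grade_sign)

lemma dir_deriv_grade_sign: "differentiable_form p \<omega> \<Longrightarrow> dir_deriv v (grade_sign \<omega>) p = grade_sign (dir_deriv v \<omega>) p"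
  by (rule ext) (rule dir_derivI[OF has_derivative_grade_sign])

lemma has_derivative_wedge:
  assumes "differentiable_form p \<alpha>" "differentiable_form p \<beta>"
  shows "((\<lambda>y. (\<alpha> \<and>\<^sub>f \<beta>) y vs) has_derivative
      (\<lambda>v. (dir_deriv v \<alpha> \<and>\<^sub>f \<beta>) p vs + (\<alpha> \<and>\<^sub>f dir_deriv v \<beta>) p vs)) (at p)"
  using assms
proof (induction vs arbitrary: \<alpha> \<beta>)
  case Nil
  have "((\<lambda>y. \<alpha> y [] * \<beta> y []) has_derivative
      (\<lambda>v. \<alpha> p [] * dir_deriv v \<beta> p [] + dir_deriv v \<alpha> p [] * \<beta> p [])) (at p)"
    by (intro has_derivative_mult differentiable_form_dir Nil)
  then show ?case by (simp add: wedge_Nil add.commute)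
next
  case (Cons w vs)
  have sign: "(dir_deriv v (grade_sign \<alpha>) \<and>\<^sub>f \<gamma>) p vs = (grade_sign (dir_deriv v \<alpha>) \<and>\<^sub>f \<gamma>) p vs" for v \<gamma>
    by (intro fun_cong[OF wedge_local] dir_deriv_grade_sign Cons.prems refl)
  have "((\<lambda>y. (contract w \<alpha> \<and>\<^sub>f \<beta>) y vs + (grade_sign \<alpha> \<and>\<^sub>f contract w \<beta>) y vs) has_derivative
      (\<lambda>v. ((dir_deriv v (contract w \<alpha>) \<and>\<^sub>f \<beta>) p vs + (contract w \<alpha> \<and>\<^sub>f dir_deriv v \<beta>) p vs)
        + ((dir_deriv v (grade_sign \<alpha>) \<and>\<^sub>f contract w \<beta>) p vs
        + (grade_sign \<alpha> \<and>\<^sub>f dir_deriv v (contract w \<beta>)) p vs))) (at p)"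
    by (intro has_derivative_add Cons.IH differentiable_form_contract differentiable_form_grade_sign Cons.prems)
  then show ?case
    by (simp add: wedge_Cons sign dir_deriv_contract add_ac)
qed

lemma differentiable_form_wedge: "differentiable_form p \<alpha> \<Longrightarrow> differentiable_form p \<beta> \<Longrightarrow> differentiable_form p (\<alpha> \<and>\<^sub>f \<beta>)"
  unfolding differentiable_form_def[of p "\<alpha> \<and>\<^sub>f \<beta>"]
  by (intro allI differentiableI) (rule has_derivative_wedge)

lemma ext_deriv_lincomb:
  assumes "\<And>i. i \<in> I \<Longrightarrow> differentiable_form p (\<omega> i)"
  shows "ext_deriv (\<lambda>y vs. \<Sum>i\<in>I. c i * \<omega> i y vs) p vs = (\<Sum>i\<in>I. c i * ext_deriv (\<omega> i) p vs)"
  using assms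
proof (induction vs arbitrary: \<omega>)
  case (Cons v vs)
  have 1: "dir_deriv v (\<lambda>y vs. \<Sum>i\<in>I. c i * \<omega> i y vs) p vs = (\<Sum>i\<in>I. c i * dir_deriv v (\<omega> i) p vs)"
    by (rule dir_derivI) (intro has_derivative_sum has_derivative_mult_right differentiable_form_dir Cons)
  have 2: "contract v (\<lambda>y vs. \<Sum>i\<in>I. c i * \<omega> i y vs) = (\<lambda>y vs. \<Sum>i\<in>I. c i * contract v (\<omega> i) y vs)"
    by (simp add: fun_eq_iff contract_def)
  show ?case
    unfolding ext_deriv_Cons 1 2
    by (subst Cons.IH) (auto simp: Cons.prems differentiable_form_contract sum_subtractf right_diff_distrib)
qed (simp add: ext_deriv_Nil)

lemma ext_deriv_lincomb2:
  assumes "differentiable_form p \<alpha>" "differentiable_form p \<beta>"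
  shows "ext_deriv (\<lambda>y vs. a * \<alpha> y vs + b * \<beta> y vs) p vs = a * ext_deriv \<alpha> p vs + b * ext_deriv \<beta> p vs"
  using ext_deriv_lincomb[of UNIV p "\<lambda>i. if i then \<alpha> else \<beta>" "\<lambda>i. if i then a else b" vs] assms
  by (simp add: UNIV_bool add.commute)

lemma ext_deriv_add:
  assumes "differentiable_form p \<alpha>" "differentiable_form p \<beta>"
  shows "ext_deriv (\<lambda>y vs. \<alpha> y vs + \<beta> y vs) p vs = ext_deriv \<alpha> p vs + ext_deriv \<beta> p vs"
  using ext_deriv_lincomb2[OF assms, of 1 1] by simp

lemma ext_deriv_local:
  assumes "open U" "p \<in> U" "\<And>y. y \<in> U \<Longrightarrow> \<alpha> y = \<beta> y"
  shows "ext_deriv \<alpha> p = ext_deriv \<beta> p"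
proof -
  have "frechet_derivative (\<lambda>y. \<alpha> y vs) (at p) = frechet_derivative (\<lambda>y. \<beta> y vs) (at p)" for vs
    by (rule frechet_derivative_cong_open[OF assms(1,2)]) (simp add: assms(3))
  then show ?thesis by (simp add: ext_deriv_def fun_eq_iff)
qed

lemma ext_deriv_grade_sign:
  assumes "differentiable_form p \<omega>"
  shows "ext_deriv (grade_sign \<omega>) p vs = - grade_sign (ext_deriv \<omega>) p vs"
  using assms
proof (induction vs arbitrary: \<omega>)
  case (Cons v vs)
  have "ext_deriv (\<lambda>y vs. - grade_sign (contract v \<omega>) y vs) p vs = - ext_deriv (grade_sign (contract v \<omega>)) p vs"
    using ext_deriv_lincomb[of UNIV p "\<lambda>_::unit. grade_sign (contract v \<omega>)" "\<lambda>_. -1" vs] Cons.prems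
    by (simp add: differentiable_form_contract differentiable_form_grade_sign UNIV_unit)
  then show ?case using Cons.prems
    by (simp add: ext_deriv_Cons contract_grade_sign Cons.IH differentiable_form_contract dir_deriv_grade_sign)
       (simp add: grade_sign_def ext_deriv_Cons algebra_simps)
qed (simp add: ext_deriv_Nil grade_sign_Nil)

text \<open>
  The graded Leibniz rule.  Both sides have the same contraction with every \<open>v\<close>, by Cartan's formula
  and because contraction is a graded derivation.
\<close>

lemma ext_deriv_wedge:
  assumes "differentiable_form p \<alpha>" "differentiable_form p \<beta>"
  shows "ext_deriv (\<alpha> \<and>\<^sub>f \<beta>) p vs = (ext_deriv \<alpha> \<and>\<^sub>f \<beta>) p vs + (grade_sign \<alpha> \<and>\<^sub>f ext_deriv \<beta>) p vs"
  using assms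
proof (induction vs arbitrary: \<alpha> \<beta>)
  case Nil
  then show ?case by (simp add: ext_deriv_Nil wedge_Nil)
next
  case (Cons v vs)
  have c: "contract v (ext_deriv \<omega>) = (\<lambda>p vs. dir_deriv v \<omega> p vs - ext_deriv (contract v \<omega>) p vs)" for \<omega>
    by (simp add: fun_eq_iff contract_def[of v "ext_deriv \<omega>"] ext_deriv_Cons)
  have s: "(ext_deriv (grade_sign \<alpha>) \<and>\<^sub>f \<gamma>) p vs = - (grade_sign (ext_deriv \<alpha>) \<and>\<^sub>f \<gamma>) p vs" for \<gamma>
  proof -
    have "(ext_deriv (grade_sign \<alpha>) \<and>\<^sub>f \<gamma>) p = ((\<lambda>p vs. - grade_sign (ext_deriv \<alpha>) p vs) \<and>\<^sub>f \<gamma>) p"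
      using Cons.prems by (intro wedge_local) (auto simp: ext_deriv_grade_sign)
    then show ?thesis by (simp add: wedge_linear)
  qed
  show ?case
    using Cons.prems
    by (simp add: ext_deriv_Cons dir_derivI[OF has_derivative_wedge] contract_wedge ext_deriv_add
        Cons.IH differentiable_form_contract differentiable_form_grade_sign differentiable_form_wedge wedge_Cons c wedge_diff_right s
        wedge_linear contract_grade_sign grade_sign_grade_sign)
qed

lemma ext_deriv_one_form:
  "ext_deriv (one_form a) p [v, w]
    = frechet_derivative (\<lambda>y. a y w) (at p) v - frechet_derivative (\<lambda>y. a y v) (at p) w"
  by (simp add: ext_deriv_Cons ext_deriv_Nil dir_deriv_def) (simp add: contract_def one_form_eval)

lemma ext_deriv_scalar_form: "ext_deriv (scalar_form f) = one_form (\<lambda>p. frechet_derivative f (at p))"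
proof (intro ext)
  fix p vs show "ext_deriv (scalar_form f) p vs = one_form (\<lambda>p. frechet_derivative f (at p)) p vs"
  proof (cases vs)
    case (Cons v us)
    have "contract v (scalar_form f) = (\<lambda>p vs. 0)"
      by (simp add: fun_eq_iff contract_def scalar_form_def)
    moreover have "frechet_derivative (\<lambda>y. 0) (at p) v = (0::real)"
      by simp
    ultimately show ?thesis using Cons
      by (cases us) (simp_all add: ext_deriv_Cons dir_deriv_def scalar_form_def one_form_eval ext_deriv_def)
  qed (simp add: ext_deriv_Nil one_form_eval)
qed

lemma ext_deriv_scale:
  assumes "f differentiable at p" "differentiable_form p \<omega>"
  shows "ext_deriv (\<lambda>y vs. f y * \<omega> y vs) p vs
    = (one_form (\<lambda>p. frechet_derivative f (at p)) \<and>\<^sub>f \<omega>) p vs + f p * ext_deriv \<omega> p vs"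
proof -
  have 1: "(\<lambda>y vs. f y * \<omega> y vs) = scalar_form f \<and>\<^sub>f \<omega>"
    by (simp add: fun_eq_iff scalar_form_wedge)
  have 2: "differentiable_form p (scalar_form f)"
    unfolding differentiable_form_def
  proof
    show "(\<lambda>y. scalar_form f y vs) differentiable at p" for vs
      using assms(1) by (cases "vs = []") (simp_all add: scalar_form_def)
  qed
  have 3: "grade_sign (scalar_form f) = scalar_form f"
    by (simp add: fun_eq_iff grade_sign_def scalar_form_def)
  show ?thesis
    by (simp only: 1 ext_deriv_wedge[OF 2 assms(2)] ext_deriv_scalar_form 3 scalar_form_wedge)
qed

lemma ext_deriv_fun_lincomb:
  assumes "\<And>i. i \<in> I \<Longrightarrow> c i differentiable at p" "\<And>i. i \<in> I \<Longrightarrow> differentiable_form p (\<omega> i)"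
  shows "ext_deriv (\<lambda>y vs. \<Sum>i\<in>I. c i y * \<omega> i y vs) p vs
    = (\<Sum>i\<in>I. (one_form (\<lambda>p. frechet_derivative (c i) (at p)) \<and>\<^sub>f \<omega> i) p vs + c i p * ext_deriv (\<omega> i) p vs)"
proof -
  have "ext_deriv (\<lambda>y vs. \<Sum>i\<in>I. 1 * (c i y * \<omega> i y vs)) p vs
      = (\<Sum>i\<in>I. 1 * ext_deriv (\<lambda>y vs. c i y * \<omega> i y vs) p vs)"
    by (rule ext_deriv_lincomb) (use assms in \<open>auto simp: differentiable_form_def\<close>)
  then show ?thesis using assms by (simp add: ext_deriv_scale)
qed

section \<open>The module of forms and its ideals\<close>

definition smooth_form :: "'a::euclidean_space set \<Rightarrow> 'a form \<Rightarrow> bool" where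
  "smooth_form U \<omega> \<longleftrightarrow> (\<forall>vs. smooth_on U (\<lambda>p. \<omega> p vs))"

definition multilinear :: "('a::real_vector list \<Rightarrow> real) \<Rightarrow> bool" where
  "multilinear m \<longleftrightarrow> (\<forall>vs. \<forall>i<length vs. linear (\<lambda>v. m (vs[i := v])))"

definition alternating :: "('a list \<Rightarrow> real) \<Rightarrow> bool" where
  "alternating m \<longleftrightarrow> (\<forall>vs. \<not> distinct vs \<longrightarrow> m vs = 0)"

lemma forms_iff:
  "\<omega> \<in> forms U \<longleftrightarrow> smooth_form U \<omega> \<and> (\<forall>p\<in>U. multilinear (\<omega> p) \<and> alternating (\<omega> p))"
  by (auto simp: forms_def smooth_form_def multilinear_def alternating_def)

lemma smooth_form_differentiable: "smooth_form U \<omega> \<Longrightarrow> p \<in> U \<Longrightarrow> differentiable_form p \<omega>"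
  by (auto simp: smooth_form_def differentiable_form_def intro: smooth_on_differentiable)

lemma smooth_form_contract: "smooth_form U \<omega> \<Longrightarrow> smooth_form U (contract v \<omega>)"
  by (simp add: smooth_form_def contract_def)

lemma smooth_form_grade_sign: "open U \<Longrightarrow> smooth_form U \<omega> \<Longrightarrow> smooth_form U (grade_sign \<omega>)"
  unfolding smooth_form_def grade_sign_def by (intro allI smooth_on_mult smooth_on_const) auto

lemma smooth_form_lincomb:
  assumes "open U" "\<And>i. i \<in> I \<Longrightarrow> smooth_on U (c i)" "\<And>i. i \<in> I \<Longrightarrow> smooth_form U (\<omega> i)"
  shows "smooth_form U (\<lambda>p vs. \<Sum>i\<in>I. c i p * \<omega> i p vs)"
  unfolding smooth_form_def
  using assms by (intro allI smooth_on_sum smooth_on_mult) (auto simp: smooth_form_def)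

lemma smooth_form_wedge:
  assumes "open U" "smooth_form U \<alpha>" "smooth_form U \<beta>"
  shows "smooth_form U (\<alpha> \<and>\<^sub>f \<beta>)"
  unfolding smooth_form_def wedge_def
  using assms by (intro allI smooth_on_sum smooth_on_mult smooth_on_const) (auto simp: smooth_form_def)

lemma smooth_form_ext_deriv:
  assumes "open U" "smooth_form U \<omega>"
  shows "smooth_form U (ext_deriv \<omega>)"
  unfolding smooth_form_def ext_deriv_def
  using assms by (intro allI smooth_on_sum smooth_on_mult smooth_on_const smooth_on_derivative)
    (auto simp: smooth_form_def)

lemma linear_cmult: "linear f \<Longrightarrow> linear (\<lambda>v. c * f v :: real)"
  using linear_compose_scale_right[of f c] by simp

lemma multilinear_contract:
  fixes \<omega> :: "'a::real_vector form"
  shows "multilinear (\<omega> p) \<Longrightarrow> multilinear (contract v \<omega> p)"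
  unfolding multilinear_def
proof (intro allI impI)
  fix vs :: "'a list" and i assume "\<forall>vs. \<forall>i<length vs. linear (\<lambda>v. \<omega> p (vs[i := v]))" "i < length vs"
  then show "linear (\<lambda>w. contract v \<omega> p (vs[i := w]))"
    by (elim allE[of _ "v # vs"] allE[of _ "Suc i"]) (simp add: contract_def)
qed

lemma linear_contract:
  assumes "multilinear (\<omega> p)"
  shows "linear (\<lambda>v. contract v \<omega> p vs)"
  using assms[unfolded multilinear_def, rule_format, of 0 "undefined # vs"] by (simp add: contract_def)

lemma multilinear_grade_sign: "multilinear (\<omega> p) \<Longrightarrow> multilinear (grade_sign \<omega> p)"
  unfolding multilinear_def grade_sign_def
  by (auto intro!: linear_cmult)

lemma linear_wedge_left:
  assumes "\<And>us. linear (\<lambda>v. A v p us)"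
  shows "linear (\<lambda>v. (A v \<and>\<^sub>f \<beta>) p vs)"
proof -
  have "linear (\<lambda>v. k * A v p us * b)" for k us and b :: real
    using linear_cmult[OF assms, of "k * b" us] by (simp add: mult_ac)
  then show ?thesis unfolding wedge_def by (intro linear_compose_sum) auto
qed

lemma linear_wedge_right:
  assumes "\<And>us. linear (\<lambda>v. B v p us)"
  shows "linear (\<lambda>v. (\<alpha> \<and>\<^sub>f B v) p vs)"
proof -
  have "linear (\<lambda>v. k * b * B v p us)" for k us and b :: real
    using linear_cmult[OF assms, of "k * b" us] by (simp add: mult_ac)
  then show ?thesis unfolding wedge_def by (intro linear_compose_sum) auto
qed

lemma multilinear_wedge:
  assumes "multilinear (\<alpha> p)" "multilinear (\<beta> p)"
  shows "multilinear ((\<alpha> \<and>\<^sub>f \<beta>) p)"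
proof -
  have "linear (\<lambda>v. (\<alpha> \<and>\<^sub>f \<beta>) p (vs[i := v]))" if "i < length vs" for vs i
    using assms that
  proof (induction vs arbitrary: i \<alpha> \<beta>)
    case (Cons w vs)
    show ?case
    proof (cases i)
      case 0
      then show ?thesis using Cons.prems
        by (simp add: wedge_Cons linear_compose_add linear_wedge_left linear_wedge_right linear_contract)
    next
      case (Suc j)
      with Cons.prems show ?thesis
        by (simp add: wedge_Cons linear_compose_add Cons.IH multilinear_contract multilinear_grade_sign)
    qed
  qed simp
  then show ?thesis by (simp add: multilinear_def)
qed

text \<open>
  Vanishing on adjacent equal arguments gives antisymmetry under adjacent transpositions by
  polarisation, and these move two equal arguments next to each other.  It is the adjacent case that
  the recursions for the exterior product and the exterior derivative can handle.
\<close>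

lemma alternating_criterion:
  assumes "multilinear m" and adj: "\<And>xs v ys. m (xs @ v # v # ys) = 0"
  shows "alternating m"
proof -
  have swap: "m (xs @ v # w # ys) = - m (xs @ w # v # ys)" for xs v w ys
  proof -
    have l1: "linear (\<lambda>a. m (xs @ a # b # ys))" and l2: "linear (\<lambda>b. m (xs @ a # b # ys))" for a b
      using assms(1)[unfolded multilinear_def, rule_format, of "length xs" "xs @ a # b # ys"]
        assms(1)[unfolded multilinear_def, rule_format, of "Suc (length xs)" "xs @ a # b # ys"]
      by (simp_all add: list_update_append)
    have "0 = m (xs @ (v + w) # (v + w) # ys)" by (simp add: adj)
    also have "\<dots> = m (xs @ v # w # ys) + m (xs @ w # v # ys)"
      by (simp only: linear_add[OF l1] linear_add[OF l2]) (simp add: adj)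
    finally show ?thesis by linarith
  qed
  have far: "m (xs @ v # zs @ v # ys) = 0" for xs v zs ys
  proof (induction zs arbitrary: xs)
    case (Cons z zs)
    show ?case using swap[of xs v z "zs @ v # ys"] Cons.IH[of "xs @ [z]"] by simp
  qed (simp add: adj)
  show ?thesis
    unfolding alternating_def using far not_distinct_decomp by fastforce
qed

lemma alternating_contract: "alternating (\<omega> p) \<Longrightarrow> alternating (contract v \<omega> p)"
  by (simp add: alternating_def contract_def)

lemma alternating_grade_sign: "alternating (\<omega> p) \<Longrightarrow> alternating (grade_sign \<omega> p)"
  by (simp add: alternating_def grade_sign_def)

lemma contract_twice: "alternating (\<omega> p) \<Longrightarrow> contract v (contract v \<omega>) p = (\<lambda>vs. 0)"
  by (simp add: alternating_def contract_def fun_eq_iff)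

lemma alternating_wedge:
  assumes "multilinear (\<alpha> p)" "multilinear (\<beta> p)" "alternating (\<alpha> p)" "alternating (\<beta> p)"
  shows "alternating ((\<alpha> \<and>\<^sub>f \<beta>) p)"
proof (rule alternating_criterion)
  show "multilinear ((\<alpha> \<and>\<^sub>f \<beta>) p)" using assms by (simp add: multilinear_wedge)
  show "(\<alpha> \<and>\<^sub>f \<beta>) p (xs @ v # v # ys) = 0" for xs v ys
    using assms(3,4)
  proof (induction xs arbitrary: \<alpha> \<beta>)
    case Nil
    have 1: "(contract v (contract v \<alpha>) \<and>\<^sub>f \<beta>) p ys = 0"
      using contract_twice[where \<omega> = \<alpha>, OF Nil(1)] by (simp add: wedge_def)
    have 2: "(\<gamma> \<and>\<^sub>f contract v (contract v \<beta>)) p ys = 0" for \<gamma>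
      using contract_twice[where \<omega> = \<beta>, OF Nil(2)] by (simp add: wedge_def)
    show ?case
      by (simp add: wedge_Cons contract_wedge contract_grade_sign wedge_linear 1 2)
  next
    case (Cons x xs)
    then show ?case
      by (simp add: wedge_Cons alternating_contract alternating_grade_sign)
  qed
qed

lemma forms_contract: "\<omega> \<in> forms U \<Longrightarrow> contract v \<omega> \<in> forms U"
  by (simp add: forms_iff smooth_form_contract multilinear_contract alternating_contract)

lemma forms_grade_sign: "open U \<Longrightarrow> \<omega> \<in> forms U \<Longrightarrow> grade_sign \<omega> \<in> forms U"
  by (simp add: forms_iff smooth_form_grade_sign multilinear_grade_sign alternating_grade_sign)

lemma forms_wedge: "open U \<Longrightarrow> \<alpha> \<in> forms U \<Longrightarrow> \<beta> \<in> forms U \<Longrightarrow> \<alpha> \<and>\<^sub>f \<beta> \<in> forms U"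
  by (simp add: forms_iff smooth_form_wedge multilinear_wedge alternating_wedge)

lemma forms_lincomb:
  assumes "open U" "\<And>i. i \<in> I \<Longrightarrow> smooth_on U (c i)" "\<And>i. i \<in> I \<Longrightarrow> \<omega> i \<in> forms U"
  shows "(\<lambda>p vs. \<Sum>i\<in>I. c i p * \<omega> i p vs) \<in> forms U"
  using assms
  by (auto simp: forms_iff smooth_form_lincomb multilinear_def alternating_def
      intro!: linear_compose_sum linear_cmult)

lemma forms_diff:
  assumes "open U" "\<alpha> \<in> forms U" "\<beta> \<in> forms U"
  shows "(\<lambda>p vs. \<alpha> p vs - \<beta> p vs) \<in> forms U"
  using forms_lincomb[of U UNIV "\<lambda>b p. if b then 1 else -1" "\<lambda>b. if b then \<alpha> else \<beta>"] assms
  by (simp add: smooth_on_const UNIV_bool)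

text \<open>
  Multilinearity and the alternating property of \<open>d\<omega>\<close> at a point rest on those of \<open>\<omega>\<close> at all nearby
  points, which is why the openness of \<open>U\<close> enters.
\<close>

lemma forms_ext_deriv:
  assumes U: "open U" and w: "\<omega> \<in> forms U"
  shows "ext_deriv \<omega> \<in> forms U"
proof -
  have multi: "multilinear (ext_deriv \<omega> p)" if p: "p \<in> U" for p
  proof -
    have "linear (\<lambda>v. ext_deriv \<omega> p (vs[i := v]))" if "i < length vs" for vs i
      using that w
    proof (induction vs arbitrary: i \<omega>)
      case (Cons w vs)
      note sm = Cons.prems(2)[unfolded forms_iff]
      have df: "differentiable_form p \<omega>" using sm p smooth_form_differentiable by blast
      show ?case
      proof (cases i)
        case 0
        have 1: "linear (\<lambda>v. dir_deriv v \<omega> p vs)"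
          using differentiable_form_dir[OF df] has_derivative_linear by blast
        have lin: "contract (a *\<^sub>R v + b *\<^sub>R v') \<omega> y us = a * contract v \<omega> y us + b * contract v' \<omega> y us"
          if "y \<in> U" for y a b v v' us
        proof -
          have l: "linear (\<lambda>v. contract v \<omega> y us)" using linear_contract sm that by blast
          show ?thesis by (simp add: linear_add[OF l] linear_scale[OF l])
        qed
        have comb: "ext_deriv (contract (a *\<^sub>R v + b *\<^sub>R v') \<omega>) p vs
            = a * ext_deriv (contract v \<omega>) p vs + b * ext_deriv (contract v' \<omega>) p vs" for a b v v'
        proof -
          have "ext_deriv (contract (a *\<^sub>R v + b *\<^sub>R v') \<omega>) p
              = ext_deriv (\<lambda>y us. a * contract v \<omega> y us + b * contract v' \<omega> y us) p"
            by (rule ext_deriv_local[OF U p]) (simp add: lin fun_eq_iff)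
          then show ?thesis
            using df by (simp add: ext_deriv_lincomb2 differentiable_form_contract)
        qed
        have 2: "linear (\<lambda>v. ext_deriv (contract v \<omega>) p vs)"
          using comb[of 1 _ 1] comb[of _ _ 0 0] by (intro linearI) simp_all
        show ?thesis using linear_compose_sub[OF 1 2] 0 by (simp add: ext_deriv_Cons)
      next
        case (Suc j)
        with Cons.prems have j: "j < length vs" by simp
        have lin: "\<omega> y (vs[j := a *\<^sub>R v + b *\<^sub>R v']) = a * \<omega> y (vs[j := v]) + b * \<omega> y (vs[j := v'])"
          if "y \<in> U" for y a b v v'
        proof -
          have l: "linear (\<lambda>v. \<omega> y (vs[j := v]))" using sm that j by (simp add: multilinear_def)
          show ?thesis by (simp add: linear_add[OF l] linear_scale[OF l])
        qed
        have comb: "dir_deriv w \<omega> p (vs[j := a *\<^sub>R v + b *\<^sub>R v'])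
            = a * dir_deriv w \<omega> p (vs[j := v]) + b * dir_deriv w \<omega> p (vs[j := v'])" for a b v v'
        proof -
          have "((\<lambda>y. a * \<omega> y (vs[j := v]) + b * \<omega> y (vs[j := v'])) has_derivative
            (\<lambda>w. a * dir_deriv w \<omega> p (vs[j := v]) + b * dir_deriv w \<omega> p (vs[j := v']))) (at p)"
            by (intro has_derivative_add has_derivative_mult_right differentiable_form_dir df)
          then have "((\<lambda>y. \<omega> y (vs[j := a *\<^sub>R v + b *\<^sub>R v'])) has_derivative
            (\<lambda>w. a * dir_deriv w \<omega> p (vs[j := v]) + b * dir_deriv w \<omega> p (vs[j := v']))) (at p)"
            by (rule has_derivative_transform_within_open[OF _ U p]) (simp add: lin)
          then show ?thesis by (rule dir_derivI)
        qed
        have 1: "linear (\<lambda>v. dir_deriv w \<omega> p (vs[j := v]))"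
          using comb[of 1 _ 1] comb[of _ _ 0 0] by (intro linearI) simp_all
        have 2: "linear (\<lambda>v. ext_deriv (contract w \<omega>) p (vs[j := v]))"
          by (rule Cons.IH[OF j forms_contract[OF Cons.prems(2)]])
        show ?thesis using linear_compose_sub[OF 1 2] Suc by (simp add: ext_deriv_Cons)
      qed
    qed simp
    then show ?thesis by (simp add: multilinear_def)
  qed
  have zero: "dir_deriv v \<omega> p vs = 0" if "\<And>y. y \<in> U \<Longrightarrow> \<omega> y vs = 0" "p \<in> U" for v p vs and \<omega> :: "'a form"
    using frechet_derivative_cong_open[OF U \<open>p \<in> U\<close>, of "\<lambda>y. \<omega> y vs" "\<lambda>y. 0"] that
    by (simp add: dir_deriv_def)
  have alt: "alternating (ext_deriv \<omega> p)" if p: "p \<in> U" for p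
  proof (rule alternating_criterion[OF multi[OF p]])
    show "ext_deriv \<omega> p (xs @ v # v # ys) = 0" for xs v ys
      using w
    proof (induction xs arbitrary: \<omega>)
      case Nil
      have "ext_deriv (contract v (contract v \<omega>)) p = ext_deriv (\<lambda>y vs. 0) p"
        by (rule ext_deriv_local[OF U p]) (use Nil in \<open>simp add: forms_iff contract_twice\<close>)
      then have "ext_deriv (contract v (contract v \<omega>)) p ys = 0"
        by (simp add: ext_deriv_def)
      then show ?case
        by (simp add: ext_deriv_Cons dir_deriv_contract) (simp add: contract_def)
    next
      case (Cons x xs)
      then have "dir_deriv x \<omega> p (xs @ v # v # ys) = 0"
        by (intro zero p) (auto simp: forms_iff alternating_def)
      then show ?case
        using Cons by (simp add: ext_deriv_Cons forms_contract)
    qed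
  qed
  show ?thesis
    using multi alt w smooth_form_ext_deriv[OF U] by (simp add: forms_iff)
qed

text \<open>
  The generators may be listed with repetitions: coefficients of equal generators are added up.
\<close>

lemma ideal_genI:
  assumes U: "open U" and I: "finite I" "\<And>i. i \<in> I \<Longrightarrow> \<sigma> i \<in> S" "\<And>i. i \<in> I \<Longrightarrow> \<beta> i \<in> forms U"
    and eq: "\<And>p vs. p \<in> U \<Longrightarrow> \<omega> p vs = (\<Sum>i\<in>I. (\<beta> i \<and>\<^sub>f \<sigma> i) p vs)"
  shows "\<omega> \<in> ideal_gen U S"
proof -
  define \<gamma> where "\<gamma> \<tau> = (\<lambda>p vs. \<Sum>i\<in>{i\<in>I. \<sigma> i = \<tau>}. 1 * \<beta> i p vs)" for \<tau>
  have "\<gamma> \<tau> \<in> forms U" for \<tau>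
    unfolding \<gamma>_def by (rule forms_lincomb[OF U]) (use I smooth_on_const in auto)
  moreover have "\<omega> p vs = (\<Sum>\<tau>\<in>\<sigma> ` I. (\<gamma> \<tau> \<and>\<^sub>f \<tau>) p vs)" if "p \<in> U" for p vs
  proof -
    have "(\<gamma> \<tau> \<and>\<^sub>f \<tau>) p vs = (\<Sum>i\<in>{i\<in>I. \<sigma> i = \<tau>}. (\<beta> i \<and>\<^sub>f \<sigma> i) p vs)" for \<tau>
      unfolding \<gamma>_def wedge_sum_left[where c = "\<lambda>_ _. 1"] by (intro sum.cong) auto
    then show ?thesis
      using sum.group[OF I(1) finite_imageI[OF I(1)] order_refl, of "\<lambda>i. (\<beta> i \<and>\<^sub>f \<sigma> i) p vs" \<sigma>]
      by (simp add: eq[OF that])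
  qed
  ultimately show ?thesis
    unfolding ideal_gen_def using I by (auto intro!: exI[of _ "\<sigma> ` I"] exI[of _ \<gamma>])
qed

lemma ideal_gen_cong:
  assumes "\<omega> \<in> ideal_gen U S" "\<And>p vs. p \<in> U \<Longrightarrow> \<omega>' p vs = \<omega> p vs"
  shows "\<omega>' \<in> ideal_gen U S"
  using assms by (simp add: ideal_gen_def)

lemma ideal_gen_add:
  assumes U: "open U" and "\<omega>\<^sub>1 \<in> ideal_gen U S" "\<omega>\<^sub>2 \<in> ideal_gen U S"
  shows "(\<lambda>p vs. \<omega>\<^sub>1 p vs + \<omega>\<^sub>2 p vs) \<in> ideal_gen U S"
proof -
  obtain T\<^sub>1 \<beta>\<^sub>1 where 1: "finite T\<^sub>1" "T\<^sub>1 \<subseteq> S" "\<forall>\<sigma>\<in>T\<^sub>1. \<beta>\<^sub>1 \<sigma> \<in> forms U"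
    "\<forall>p\<in>U. \<forall>vs. \<omega>\<^sub>1 p vs = (\<Sum>\<sigma>\<in>T\<^sub>1. (\<beta>\<^sub>1 \<sigma> \<and>\<^sub>f \<sigma>) p vs)"
    using assms(2) by (auto simp: ideal_gen_def)
  obtain T\<^sub>2 \<beta>\<^sub>2 where 2: "finite T\<^sub>2" "T\<^sub>2 \<subseteq> S" "\<forall>\<sigma>\<in>T\<^sub>2. \<beta>\<^sub>2 \<sigma> \<in> forms U"
    "\<forall>p\<in>U. \<forall>vs. \<omega>\<^sub>2 p vs = (\<Sum>\<sigma>\<in>T\<^sub>2. (\<beta>\<^sub>2 \<sigma> \<and>\<^sub>f \<sigma>) p vs)"
    using assms(3) by (auto simp: ideal_gen_def)
  show ?thesis
    by (rule ideal_genI[OF U, of "T\<^sub>1 <+> T\<^sub>2" "case_sum id id" _ "case_sum \<beta>\<^sub>1 \<beta>\<^sub>2"])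
       (use 1 2 in \<open>auto simp: sum.Plus\<close>)
qed

lemma ideal_gen_sum:
  assumes U: "open U" and "\<And>i. i \<in> I \<Longrightarrow> \<omega> i \<in> ideal_gen U S"
  shows "(\<lambda>p vs. \<Sum>i\<in>I. \<omega> i p vs) \<in> ideal_gen U S"
  using assms(2)
proof (induction I rule: infinite_finite_induct)
  case (insert i I)
  then show ?case using ideal_gen_add[OF U, of "\<omega> i" S "\<lambda>p vs. \<Sum>i\<in>I. \<omega> i p vs"] by simp
qed (auto intro!: ideal_genI[OF U, of "{}"])

lemma ideal_gen_wedge:
  assumes U: "open U" and "\<alpha> \<in> forms U" "\<omega> \<in> ideal_gen U S"
  shows "\<alpha> \<and>\<^sub>f \<omega> \<in> ideal_gen U S"
proof -
  obtain T \<beta> where T: "finite T" "T \<subseteq> S" "\<forall>\<sigma>\<in>T. \<beta> \<sigma> \<in> forms U"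
    "\<forall>p\<in>U. \<forall>vs. \<omega> p vs = (\<Sum>\<sigma>\<in>T. (\<beta> \<sigma> \<and>\<^sub>f \<sigma>) p vs)"
    using assms(3) by (auto simp: ideal_gen_def)
  have "(\<alpha> \<and>\<^sub>f \<omega>) p vs = (\<Sum>\<sigma>\<in>T. ((\<alpha> \<and>\<^sub>f \<beta> \<sigma>) \<and>\<^sub>f \<sigma>) p vs)" if "p \<in> U" for p vs
  proof -
    have "(\<alpha> \<and>\<^sub>f \<omega>) p = (\<alpha> \<and>\<^sub>f (\<lambda>p vs. \<Sum>\<sigma>\<in>T. 1 * (\<beta> \<sigma> \<and>\<^sub>f \<sigma>) p vs)) p"
      by (intro wedge_local) (use T that in auto)
    then show ?thesis by (simp only: wedge_sum_right[where c = "\<lambda>_ _. 1"]) (simp add: wedge_assoc)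
  qed
  then show ?thesis
    by (rule ideal_genI[OF U T(1), of id, unfolded id_apply, rotated 2])
       (use T assms in \<open>auto intro: forms_wedge\<close>)
qed

text \<open>
  It suffices to test the generators: \<open>d(\<beta> \<and> \<sigma>)\<close> is \<open>d\<beta> \<and> \<sigma>\<close>, plus or minus \<open>\<beta> \<and> d\<sigma>\<close>, and the second
  term is in the ideal by associativity.
\<close>

lemma differential_ideal_gen:
  assumes U: "open U" and S: "S \<subseteq> forms U" and d: "\<And>\<sigma>. \<sigma> \<in> S \<Longrightarrow> ext_deriv \<sigma> \<in> ideal_gen U S"
  shows "differential_ideal (ideal_gen U S)"
  unfolding differential_ideal_def
proof
  fix \<omega> assume "\<omega> \<in> ideal_gen U S"
  then obtain T \<beta> where T: "finite T" "T \<subseteq> S" "\<forall>\<sigma>\<in>T. \<beta> \<sigma> \<in> forms U"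
    "\<forall>p\<in>U. \<forall>vs. \<omega> p vs = (\<Sum>\<sigma>\<in>T. (\<beta> \<sigma> \<and>\<^sub>f \<sigma>) p vs)"
    by (auto simp: ideal_gen_def)
  have df: "differentiable_form p (\<beta> \<sigma>)" "differentiable_form p \<sigma>" if "p \<in> U" "\<sigma> \<in> T" for p \<sigma>
    using T S that by (auto intro!: smooth_form_differentiable simp: forms_iff subset_iff)
  have eq: "ext_deriv \<omega> p vs = (\<Sum>\<sigma>\<in>T. (ext_deriv (\<beta> \<sigma>) \<and>\<^sub>f \<sigma>) p vs + (grade_sign (\<beta> \<sigma>) \<and>\<^sub>f ext_deriv \<sigma>) p vs)"
    if "p \<in> U" for p vs
  proof -
    have "ext_deriv \<omega> p vs = ext_deriv (\<lambda>p vs. \<Sum>\<sigma>\<in>T. 1 * (\<beta> \<sigma> \<and>\<^sub>f \<sigma>) p vs) p vs"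
      by (rule fun_cong[OF ext_deriv_local[OF U that]]) (use T in auto)
    also have "\<dots> = (\<Sum>\<sigma>\<in>T. 1 * ext_deriv (\<beta> \<sigma> \<and>\<^sub>f \<sigma>) p vs)"
      by (rule ext_deriv_lincomb) (intro differentiable_form_wedge df that)
    finally show ?thesis using df[OF that] by (simp add: ext_deriv_wedge)
  qed
  have "(\<lambda>p vs. \<Sum>\<sigma>\<in>T. (ext_deriv (\<beta> \<sigma>) \<and>\<^sub>f \<sigma>) p vs + (grade_sign (\<beta> \<sigma>) \<and>\<^sub>f ext_deriv \<sigma>) p vs) \<in> ideal_gen U S"
  proof (rule ideal_gen_sum[OF U], rule ideal_gen_add[OF U])
    fix \<sigma> assume \<sigma>: "\<sigma> \<in> T"
    show "ext_deriv (\<beta> \<sigma>) \<and>\<^sub>f \<sigma> \<in> ideal_gen U S"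
      by (rule ideal_genI[OF U, of "{\<sigma>}" id _ "\<lambda>\<sigma>. ext_deriv (\<beta> \<sigma>)"]) (use \<sigma> T forms_ext_deriv[OF U] in auto)
    show "grade_sign (\<beta> \<sigma>) \<and>\<^sub>f ext_deriv \<sigma> \<in> ideal_gen U S"
      by (rule ideal_gen_wedge[OF U]) (use d T \<sigma> forms_grade_sign[OF U] in auto)
  qed
  then show "ext_deriv \<omega> \<in> ideal_gen U S"
    by (rule ideal_gen_cong) (rule eq)
qed

lemma ideal_gen_pair:
  assumes "open U" "\<omega> \<in> ideal_gen U {\<sigma>, \<tau>}"
  obtains \<alpha> \<beta> where "\<alpha> \<in> forms U" "\<beta> \<in> forms U"
    "\<And>p vs. p \<in> U \<Longrightarrow> \<omega> p vs = (\<alpha> \<and>\<^sub>f \<sigma>) p vs + (\<beta> \<and>\<^sub>f \<tau>) p vs"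
proof -
  have 0: "(\<lambda>p vs. 0) \<in> forms U" using forms_lincomb[OF assms(1), of "{}"] by simp
  obtain T \<gamma> where T: "T \<subseteq> {\<sigma>, \<tau>}" "\<forall>\<rho>\<in>T. \<gamma> \<rho> \<in> forms U"
    and \<omega>: "\<forall>p\<in>U. \<forall>vs. \<omega> p vs = (\<Sum>\<rho>\<in>T. (\<gamma> \<rho> \<and>\<^sub>f \<rho>) p vs)"
    using assms(2) unfolding ideal_gen_def by blast
  show thesis
  proof
    show "(if \<sigma> \<in> T then \<gamma> \<sigma> else (\<lambda>p vs. 0)) \<in> forms U" using T 0 by auto
    show "(if \<tau> \<in> T \<and> \<tau> \<noteq> \<sigma> then \<gamma> \<tau> else (\<lambda>p vs. 0)) \<in> forms U" using T 0 by auto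
    fix p vs assume p: "p \<in> U"
    have "T = {} \<or> T = {\<sigma>} \<or> T = {\<tau>} \<or> T = {\<sigma>, \<tau>}" using T(1) by blast
    then show "\<omega> p vs = ((if \<sigma> \<in> T then \<gamma> \<sigma> else (\<lambda>p vs. 0)) \<and>\<^sub>f \<sigma>) p vs
        + ((if \<tau> \<in> T \<and> \<tau> \<noteq> \<sigma> then \<gamma> \<tau> else (\<lambda>p vs. 0)) \<and>\<^sub>f \<tau>) p vs"
      using \<omega> p by (cases "\<sigma> = \<tau>") (auto simp: wedge_zero_left)
  qed
qed

text \<open>
  Over an injectively indexed finite family, coefficients can be indexed by the indices instead of
  by the forms themselves.
\<close>

lemma Sp_range:
  fixes s :: "'i::finite \<Rightarrow> 'a::euclidean_space form"
  assumes "inj s"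
  shows "\<omega> \<in> Sp U (range s) \<longleftrightarrow>
    (\<exists>g. (\<forall>i. smooth_on U (g i)) \<and> (\<forall>p\<in>U. \<forall>vs. \<omega> p vs = (\<Sum>i\<in>UNIV. g i p * s i p vs)))"
proof
  assume "\<omega> \<in> Sp U (range s)"
  then obtain T c where T: "finite T" "T \<subseteq> range s" "\<forall>\<tau>\<in>T. smooth_on U (c \<tau>)"
    and \<omega>: "\<forall>p\<in>U. \<forall>vs. \<omega> p vs = (\<Sum>\<tau>\<in>T. c \<tau> p * \<tau> p vs)"
    unfolding Sp_def by blast
  define g where "g i = (if s i \<in> T then c (s i) else (\<lambda>_. 0))" for i
  have "(\<Sum>i\<in>UNIV. g i p * s i p vs) = (\<Sum>\<tau>\<in>T. c \<tau> p * \<tau> p vs)" for p vs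
  proof -
    have "(\<Sum>i\<in>UNIV. g i p * s i p vs) = (\<Sum>i\<in>s -` T. c (s i) p * s i p vs)"
      by (rule sum.mono_neutral_cong_right) (auto simp: g_def)
    also have "\<dots> = (\<Sum>\<tau>\<in>s ` (s -` T). c \<tau> p * \<tau> p vs)"
      using assms by (subst sum.reindex) (auto intro: inj_on_subset)
    also have "s ` (s -` T) = T" using T(2) by auto
    finally show ?thesis .
  qed
  moreover have "smooth_on U (g i)" for i using T(3) by (simp add: g_def smooth_on_const)
  ultimately show "\<exists>g. (\<forall>i. smooth_on U (g i)) \<and> (\<forall>p\<in>U. \<forall>vs. \<omega> p vs = (\<Sum>i\<in>UNIV. g i p * s i p vs))"
    using \<omega> by (intro exI[of _ g]) simp
next
  assume "\<exists>g. (\<forall>i. smooth_on U (g i)) \<and> (\<forall>p\<in>U. \<forall>vs. \<omega> p vs = (\<Sum>i\<in>UNIV. g i p * s i p vs))"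
  then obtain g where g: "\<And>i. smooth_on U (g i)" "\<And>p vs. p \<in> U \<Longrightarrow> \<omega> p vs = (\<Sum>i\<in>UNIV. g i p * s i p vs)"
    by blast
  have "\<omega> p vs = (\<Sum>\<tau>\<in>range s. g (inv s \<tau>) p * \<tau> p vs)" if "p \<in> U" for p vs
    using assms by (subst sum.reindex) (simp_all add: g(2)[OF that])
  then show "\<omega> \<in> Sp U (range s)"
    unfolding Sp_def using g(1) by (intro CollectI exI[of _ "range s"] exI[of _ "\<lambda>\<tau>. g (inv s \<tau>)"]) simp
qed

section \<open>Dimension counts\<close>

lemma dim_span_family:
  fixes b :: "nat \<Rightarrow> 'b::euclidean_space"
  assumes "\<And>c i. (\<Sum>i<r. c i *\<^sub>R b i) = 0 \<Longrightarrow> i < r \<Longrightarrow> c i = 0"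
  shows "dim (span (b ` {..<r})) = r"
proof -
  have inj: "inj_on b {..<r}"
  proof (rule inj_onI, rule ccontr)
    fix i j assume ij: "i \<in> {..<r}" "j \<in> {..<r}" "b i = b j" "i \<noteq> j"
    let ?c = "\<lambda>k. (if k = i then 1 else 0) - (if k = j then 1 else 0) :: real"
    have "(\<Sum>k<r. ?c k *\<^sub>R b k) = (\<Sum>k<r. if k = i then b k else 0) - (\<Sum>k<r. if k = j then b k else 0)"
      unfolding sum_subtractf[symmetric] by (intro sum.cong) auto
    also have "\<dots> = 0" using ij by simp
    finally have "?c i = 0" using assms[of ?c i] ij by simp
    then show False using ij by simp
  qed
  have "independent (b ` {..<r})"
  proof (rule independent_if_scalars_zero)
    fix f x assume "(\<Sum>x\<in>b ` {..<r}. f x *\<^sub>R x) = 0" "x \<in> b ` {..<r}"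
    then show "f x = 0" using assms[of "\<lambda>i. f (b i)"] by (auto simp: sum.reindex[OF inj])
  qed simp
  then show ?thesis by (simp add: dim_eq_card_independent card_image[OF inj])
qed

text \<open>
  The vector \<open>g\<close> leaves the coordinate subspace of \<open>A\<close>, as its component at \<open>b\<close> is nonzero.
\<close>

lemma dim_ge_axes_and_vector:
  fixes V :: "(real ^ 'n) set"
  assumes V: "subspace V" and axes: "\<And>a. a \<in> A \<Longrightarrow> axis a 1 \<in> V"
    and g: "g \<in> V" "g $ b \<noteq> 0" and b: "b \<notin> A"
  shows "Suc (card A) \<le> dim V"
proof -
  let ?B = "(\<lambda>a. axis a 1 :: real ^ 'n) ` A"
  have "independent ?B"
    by (rule independent_mono[OF independent_Basis]) (auto simp: Basis_vec_def)
  moreover have "span ?B \<subseteq> {x. x $ b = 0}"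
    using b by (intro span_minimal) (auto simp: axis_def subspace_def)
  then have "g \<notin> span ?B" using g by blast
  ultimately have "independent (insert g ?B)" by (simp add: independent_insert)
  moreover have "insert g ?B \<subseteq> V" using g axes by blast
  ultimately have "card (insert g ?B) \<le> dim V" by (rule independent_card_le_dim[rotated])
  moreover have "g \<notin> ?B" using \<open>g \<notin> span ?B\<close> span_superset[of ?B] by (rule contra_subsetD[rotated])
  moreover have "card ?B = card A" by (rule card_image) (auto simp: inj_on_def axis_eq_axis)
  ultimately show ?thesis by simp
qed

section \<open>The adapted frame of a second-order system\<close>

definition lift_V :: "real ^ 'n \<Rightarrow> 'n::finite evol" where
  "lift_V x = (0, 0, x)"

text \<open>
  The components of \<open>x\<^sup>a H\<^sub>a\<close>, with \<open>H\<^sub>a = \<partial>/\<partial>x\<^sup>a - \<Gamma>\<^sup>b\<^sub>a \<partial>/\<partial>u\<^sup>b\<close>.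
\<close>

definition lift_H :: "('n::finite evol \<Rightarrow> real ^ 'n) \<Rightarrow> 'n evol \<Rightarrow> real ^ 'n \<Rightarrow> 'n evol" where
  "lift_H F p x = (0, x, - (conn F p *v x))"

lemma theta_eq: "theta a p v = fst (snd v) $ a - snd (snd p) $ a * fst v"
  by (cases p; cases v) (simp add: theta_def split_beta)

lemma psi_eq: "psi F a p v = snd (snd v) $ a - F p $ a * fst v + (\<Sum>b\<in>UNIV. conn F p $ a $ b * theta b p v)"
  by (cases v) (simp add: psi_def split_beta)

lemma sode_eq: "sode F p = (1, snd (snd p), F p)"
  by (simp add: sode_def split_beta)

lemma theta_lifts:
  "theta a p (sode F p) = 0" "theta a p (lift_V x) = 0" "theta a p (lift_H F p x) = x $ a"
  by (simp_all add: theta_eq sode_eq lift_V_def lift_H_def)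

lemma psi_lifts:
  "psi F a p (sode F p) = 0" "psi F a p (lift_V x) = x $ a" "psi F a p (lift_H F p x) = 0"
  by (simp_all add: psi_eq theta_lifts)
    (simp_all add: sode_eq lift_V_def lift_H_def matrix_vector_mult_def)

lemma smooth_on_component: "open U \<Longrightarrow> smooth_on U F \<Longrightarrow> smooth_on U (\<lambda>y. F y $ a)"
  by (rule smooth_on_bounded_linear[OF _ bounded_linear_vec_nth])

lemma smooth_on_conn: "open U \<Longrightarrow> smooth_on U F \<Longrightarrow> smooth_on U (\<lambda>p. conn F p $ a $ b)"
  by (simp only: conn_def vec_lambda_beta)
    (intro smooth_on_mult smooth_on_const smooth_on_derivative smooth_on_component)

lemma smooth_on_theta: "open U \<Longrightarrow> smooth_on U (\<lambda>p. theta a p v)"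
  unfolding theta_eq
  by (intro smooth_on_diff smooth_on_mult smooth_on_const smooth_on_linear)
    (auto intro!: bounded_linear_compose[OF bounded_linear_vec_nth] bounded_linear_compose[OF bounded_linear_snd]
      bounded_linear_snd)

lemma smooth_on_psi:
  assumes "open U" "smooth_on U F"
  shows "smooth_on U (\<lambda>p. psi F a p v)"
  unfolding psi_eq using assms
  by (intro smooth_on_add smooth_on_sum smooth_on_diff smooth_on_mult smooth_on_const smooth_on_theta
      smooth_on_component smooth_on_conn)

lemma smooth_form_one_form: "(\<And>v. smooth_on U (\<lambda>p. A p v)) \<Longrightarrow> smooth_form U (one_form A)"
  unfolding smooth_form_def
proof
  assume sm: "\<And>v. smooth_on U (\<lambda>p. A p v)"
  show "smooth_on U (\<lambda>p. one_form A p vs)" for vs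
    by (induction vs rule: induct_list012) (simp_all add: one_form_eval sm smooth_on_const)
qed

lemma has_derivative_frechet:
  "f differentiable at p \<Longrightarrow> (f has_derivative frechet_derivative f (at p)) (at p)"
  by (simp add: frechet_derivative_works[symmetric])

text \<open>
  The Jacobi endomorphism as a curvature component: \<open>d\<psi>\<^sup>b(\<Gamma>, H\<^sub>c) = - \<Phi>\<^sup>b\<^sub>c\<close>.  The vectors at which \<open>d\<psi>\<^sup>b\<close>
  is evaluated are frozen at \<open>p\<close>, so only the coefficients of \<open>\<psi>\<^sup>b\<close> are differentiated: along \<open>\<Gamma>\<close> this
  produces \<open>\<Gamma>(\<Gamma>\<^sup>b\<^sub>c)\<close>, and along \<open>H\<^sub>c\<close> the derivatives of \<open>F\<^sup>b\<close> together with a term from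
  \<open>\<theta>\<^sup>d = dx\<^sup>d - u\<^sup>d dt\<close>, whose \<open>dt\<close> coefficient depends on the point.
\<close>

lemma ext_deriv_psi:
  assumes U: "open U" and F: "smooth_on U F" and p: "p \<in> U"
  shows "ext_deriv (one_form (psi F b)) p [sode F p, lift_H F p x] = - (Phi F p *v x) $ b"
proof -
  let ?w = "lift_H F p x" and ?v = "sode F p"
  let ?C = "\<lambda>c. frechet_derivative (\<lambda>y. conn F y $ b $ c) (at p)"
  let ?D = "frechet_derivative (\<lambda>y. F y $ b) (at p)"
  have dC: "((\<lambda>y. conn F y $ b $ c) has_derivative ?C c) (at p)" for c
    using smooth_on_differentiable[OF smooth_on_conn[OF U F] p] by (rule has_derivative_frechet)
  have dF: "((\<lambda>y. F y $ b) has_derivative ?D) (at p)"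
    using smooth_on_differentiable[OF smooth_on_component[OF U F] p] by (rule has_derivative_frechet)
  have "((\<lambda>y. psi F b y ?w) has_derivative (\<lambda>z. \<Sum>c\<in>UNIV. ?C c z * x $ c)) (at p)"
    unfolding psi_eq theta_eq lift_H_def fst_conv snd_conv
    by (auto intro!: derivative_eq_intros dC)
  then have 1: "frechet_derivative (\<lambda>y. psi F b y ?w) (at p) ?v = (\<Sum>c\<in>UNIV. ?C c ?v * x $ c)"
    by (simp add: frechet_derivative_at[symmetric])
  have dU: "((\<lambda>y::'a evol. snd (snd y) $ c) has_derivative (\<lambda>z. snd (snd z) $ c)) (at p)" for c
    by (intro bounded_linear_imp_has_derivative bounded_linear_compose[OF bounded_linear_vec_nth]
        bounded_linear_compose[OF bounded_linear_snd] bounded_linear_snd)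
  have "((\<lambda>y. psi F b y ?v) has_derivative
      (\<lambda>z. 0 - ?D z + (\<Sum>c\<in>UNIV. conn F p $ b $ c * (0 - snd (snd z) $ c)
        + ?C c z * (snd (snd p) $ c - snd (snd p) $ c)))) (at p)"
    unfolding psi_eq theta_eq sode_eq fst_conv snd_conv mult_1_right
    by (intro has_derivative_add has_derivative_diff has_derivative_const has_derivative_sum
        has_derivative_mult dC dF dU)
  then have 2: "frechet_derivative (\<lambda>y. psi F b y ?v) (at p) ?w
      = - ?D ?w + (\<Sum>c\<in>UNIV. conn F p $ b $ c * (conn F p *v x) $ c)"
    by (simp add: frechet_derivative_at[symmetric] lift_H_def)
  have linD: "linear ?D" using dF has_derivative_linear by blast
  have "?w = (\<Sum>c\<in>UNIV. x $ c *\<^sub>R (0, axis c 1, 0)) + (\<Sum>c\<in>UNIV. - (conn F p *v x) $ c *\<^sub>R (0, 0, axis c 1))"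
  proof -
    have "y = (\<Sum>c\<in>UNIV. y $ c *\<^sub>R axis c 1)" for y :: "real ^ 'a"
      by (simp add: vec_eq_iff axis_def if_distrib[of "\<lambda>t. _ * t"] cong: if_cong)
    then show ?thesis
      by (simp add: lift_H_def prod_eq_iff fst_sum snd_sum sum_negf)
  qed
  then have "?D ?w = (\<Sum>c\<in>UNIV. x $ c * ?D (0, axis c 1, 0))
      + (\<Sum>c\<in>UNIV. - (conn F p *v x) $ c * ?D (0, 0, axis c 1))"
    by (simp only: linear_add[OF linD] linear_sum[OF linD] linear_scale[OF linD] real_scaleR_def)
  moreover have "?D (0, 0, axis c 1) = - 2 * conn F p $ b $ c" for c
    by (simp add: conn_def)
  ultimately have 3: "?D ?w = (\<Sum>c\<in>UNIV. x $ c * ?D (0, axis c 1, 0))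
      + 2 * (\<Sum>c\<in>UNIV. conn F p $ b $ c * (conn F p *v x) $ c)"
    by (simp add: sum_distrib_left mult_ac)
  have 4: "(\<Sum>c\<in>UNIV. conn F p $ b $ c * (conn F p *v x) $ c)
      = (\<Sum>c\<in>UNIV. (\<Sum>d\<in>UNIV. conn F p $ d $ c * conn F p $ b $ d) * x $ c)"
    unfolding matrix_vector_mult_def vec_lambda_beta sum_distrib_left sum_distrib_right
    by (subst sum.swap) (simp add: mult_ac)
  have 5: "(Phi F p *v x) $ b = - (\<Sum>c\<in>UNIV. x $ c * ?D (0, axis c 1, 0))
      - (\<Sum>c\<in>UNIV. (\<Sum>d\<in>UNIV. conn F p $ d $ c * conn F p $ b $ d) * x $ c) - (\<Sum>c\<in>UNIV. ?C c ?v * x $ c)"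
    by (simp add: Phi_def matrix_vector_mult_def left_diff_distrib sum_subtractf sum_negf mult.commute[of "x $ _"])
  show ?thesis
    unfolding ext_deriv_one_form 1 2 3 4 5 by linarith
qed

text \<open>
  A second-order system with a smooth eigenframe of its Jacobi endomorphism \<open>\<Phi>\<close>.  All evaluations of
  forms are made on the frame \<open>\<Gamma>\<close>, \<open>X\<^sub>e\<^sup>V\<close>, \<open>X\<^sub>e\<^sup>H\<close> adapted to it.
\<close>

locale eigen_sode =
  fixes F :: "'n::finite evol \<Rightarrow> real ^ 'n" and U :: "'n evol set"
    and X \<phi> :: "'n \<Rightarrow> 'n evol \<Rightarrow> real ^ 'n" and ev :: "'n \<Rightarrow> 'n evol \<Rightarrow> real"
  assumes U: "open U" and F: "smooth_on U F" and eigen: "eigenframe F U X ev"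
    and dual: "dual_frame U X \<phi>"
begin

definition vert :: "'n evol \<Rightarrow> 'n \<Rightarrow> 'n evol" where "vert p e = lift_V (X e p)"

definition horiz :: "'n evol \<Rightarrow> 'n \<Rightarrow> 'n evol" where "horiz p e = lift_H F p (X e p)"

definition diag_form :: "'n \<Rightarrow> 'n evol form" where "diag_form a = phiV F \<phi> a \<and>\<^sub>f phiH \<phi> a"

lemma phi_X: "p \<in> U \<Longrightarrow> (\<Sum>c\<in>UNIV. \<phi> a p $ c * X b p $ c) = (if a = b then 1 else 0)"
  using dual by (simp add: dual_frame_def)

lemma phiV_eval:
  assumes "p \<in> U"
  shows "phiV F \<phi> a p [sode F p] = 0" "phiV F \<phi> a p [vert p e] = (if a = e then 1 else 0)"
    "phiV F \<phi> a p [horiz p e] = 0"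
  using assms by (simp_all add: phiV_def one_form_eval vert_def horiz_def psi_lifts phi_X)

lemma phiH_eval:
  assumes "p \<in> U"
  shows "phiH \<phi> a p [sode F p] = 0" "phiH \<phi> a p [vert p e] = 0"
    "phiH \<phi> a p [horiz p e] = (if a = e then 1 else 0)"
  using assms by (simp_all add: phiH_def one_form_eval vert_def horiz_def theta_lifts phi_X)

lemma smooth_on_phi: "smooth_on U (\<lambda>p. \<phi> a p $ b)"
  using dual U by (intro smooth_on_component) (auto simp: dual_frame_def)

lemma smooth_form_phiV: "smooth_form U (phiV F \<phi> a)"
  unfolding phiV_def
  by (intro smooth_form_one_form smooth_on_sum smooth_on_mult U smooth_on_phi smooth_on_psi F)

lemma smooth_form_phiH: "smooth_form U (phiH \<phi> a)"
  unfolding phiH_def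
  by (intro smooth_form_one_form smooth_on_sum smooth_on_mult U smooth_on_phi smooth_on_theta)

lemma phiV_wedge_pair: "(phiV F \<phi> a \<and>\<^sub>f \<eta>) p [v, w] = phiV F \<phi> a p [v] * \<eta> p [w] - phiV F \<phi> a p [w] * \<eta> p [v]"
  by (simp add: phiV_def one_form_wedge_pair one_form_eval)

lemma wedge_eval:
  assumes "p \<in> U"
  shows "(phiV F \<phi> a \<and>\<^sub>f phiH \<phi> b) p [sode F p, horiz p e] = 0"
    "(phiV F \<phi> a \<and>\<^sub>f phiH \<phi> b) p [horiz p e, horiz p f] = 0"
    "(phiV F \<phi> a \<and>\<^sub>f phiH \<phi> b) p [vert p e, horiz p f] = (if a = e \<and> b = f then 1 else 0)"
  using assms by (simp_all add: phiV_wedge_pair phiV_eval phiH_eval)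

text \<open>
  The derivatives of the coefficients \<open>\<phi>\<^sup>a\<^sub>b\<close> drop out because every \<open>\<psi>\<^sup>b\<close> vanishes on \<open>\<Gamma>\<close> and on
  horizontal vectors; the rest is \<open>- \<phi>\<^sup>a(\<Phi> X\<^sub>e)\<close>, and \<open>X\<^sub>e\<close> is an eigenvector.
\<close>

lemma ext_deriv_phiV:
  assumes p: "p \<in> U"
  shows "ext_deriv (phiV F \<phi> a) p [sode F p, horiz p e] = (if a = e then - ev e p else 0)"
proof -
  have "phiV F \<phi> a = (\<lambda>p vs. \<Sum>b\<in>UNIV. \<phi> a p $ b * one_form (psi F b) p vs)"
    by (auto simp: phiV_def one_form_def fun_eq_iff split: list.split)
  moreover have "differentiable_form p (one_form (psi F b))" for b
    by (rule smooth_form_differentiable[OF smooth_form_one_form p]) (rule smooth_on_psi[OF U F])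
  moreover have "(\<lambda>p. \<phi> a p $ b) differentiable (at p)" for b
    using smooth_on_differentiable[OF smooth_on_phi p] .
  ultimately have "ext_deriv (phiV F \<phi> a) p [sode F p, horiz p e]
      = (\<Sum>b\<in>UNIV. \<phi> a p $ b * - (Phi F p *v X e p) $ b)"
    by (simp add: ext_deriv_fun_lincomb one_form_wedge_pair one_form_eval horiz_def psi_lifts
        ext_deriv_psi[OF U F p])
  also have "Phi F p *v X e p = ev e p *\<^sub>R X e p"
    using eigen p by (simp add: eigenframe_def)
  also have "(\<Sum>b\<in>UNIV. \<phi> a p $ b * - (ev e p *\<^sub>R X e p) $ b) = - ev e p * (\<Sum>b\<in>UNIV. \<phi> a p $ b * X e p $ b)"
    by (simp add: sum_distrib_left sum_negf mult_ac)
  finally show ?thesis using p by (simp add: phi_X)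
qed

text \<open>
  In the Leibniz rule the term with \<open>d\<phi>\<^sup>b\<^sup>H\<close> vanishes, as \<open>\<phi>\<^sup>a\<^sup>V\<close> kills \<open>\<Gamma>\<close> and all horizontal vectors.
\<close>

lemma ext_deriv_phiV_wedge_phiH:
  assumes p: "p \<in> U"
  shows "ext_deriv (phiV F \<phi> a \<and>\<^sub>f phiH \<phi> b) p [sode F p, horiz p e, horiz p f]
    = (if a = f \<and> b = e then ev f p else 0) - (if a = e \<and> b = f then ev e p else 0)"
proof -
  have 1: "ext_deriv (phiV F \<phi> a) \<and>\<^sub>f phiH \<phi> b = phiH \<phi> b \<and>\<^sub>f grade_sign (ext_deriv (phiV F \<phi> a))"
    unfolding phiH_def by (simp add: one_form_wedge_commute grade_sign_grade_sign)
  have 2: "(phiH \<phi> b \<and>\<^sub>f \<eta>) p [v, w, x]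
      = phiH \<phi> b p [v] * \<eta> p [w, x] - phiH \<phi> b p [w] * \<eta> p [v, x] + phiH \<phi> b p [x] * \<eta> p [v, w]" for \<eta> v w x
    by (simp add: phiH_def one_form_wedge_triple one_form_eval)
  have 3: "(grade_sign (phiV F \<phi> a) \<and>\<^sub>f \<eta>) p [v, w, x]
      = - (phiV F \<phi> a p [v] * \<eta> p [w, x] - phiV F \<phi> a p [w] * \<eta> p [v, x] + phiV F \<phi> a p [x] * \<eta> p [v, w])" for \<eta> v w x
    by (simp add: phiV_def grade_sign_one_form wedge_minus_left one_form_wedge_triple one_form_eval)
  have d: "differentiable_form p (phiV F \<phi> a)" "differentiable_form p (phiH \<phi> b)"
    using smooth_form_differentiable p smooth_form_phiV smooth_form_phiH by blast+
  let ?vs = "[sode F p, horiz p e, horiz p f]"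
  have 4: "ext_deriv (phiV F \<phi> a \<and>\<^sub>f phiH \<phi> b) p ?vs
      = (phiH \<phi> b \<and>\<^sub>f grade_sign (ext_deriv (phiV F \<phi> a))) p ?vs
        + (grade_sign (phiV F \<phi> a) \<and>\<^sub>f ext_deriv (phiH \<phi> b)) p ?vs"
    using ext_deriv_wedge[OF d, of ?vs] by (simp only: 1)
  have 5: "(grade_sign (phiV F \<phi> a) \<and>\<^sub>f ext_deriv (phiH \<phi> b)) p ?vs = 0"
    by (simp add: 3 phiV_eval[OF p])
  have 6: "(phiH \<phi> b \<and>\<^sub>f grade_sign (ext_deriv (phiV F \<phi> a))) p ?vs
      = (if b = f then ext_deriv (phiV F \<phi> a) p [sode F p, horiz p e] else 0)
        - (if b = e then ext_deriv (phiV F \<phi> a) p [sode F p, horiz p f] else 0)"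
    by (simp only: 2 phiH_eval[OF p]) (simp add: grade_sign_def)
  have 7: "ext_deriv (phiV F \<phi> a \<and>\<^sub>f phiH \<phi> b) p ?vs
      = (if b = f then if a = e then - ev e p else 0 else 0) - (if b = e then if a = f then - ev f p else 0 else 0)"
    by (simp only: 4 5 6 ext_deriv_phiV[OF p] add_0_right)
  show ?thesis
    unfolding 7 by (cases "a = e"; cases "b = f"; cases "a = f"; cases "b = e"; simp)
qed

text \<open>
  Every generator \<open>\<tau>\<close> of \<open>\<Sigma>\<^sup>0\<close> satisfies \<open>d\<tau>(\<Gamma>, X\<^sub>e\<^sup>H, X\<^sub>f\<^sup>H) = (\<lambda>\<^sub>f - \<lambda>\<^sub>e) \<tau>(X\<^sub>e\<^sup>V, X\<^sub>f\<^sup>H)\<close>, and \<open>\<tau>\<close> vanishes on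
  pairs taken from \<open>\<Gamma>\<close> and the horizontal vectors.  So the same identity holds for all of \<open>\<Sigma>\<^sup>0\<close>,
  with function coefficients, and closed elements have no off-diagonal components.
\<close>

lemma closed_Sigma0_diagonal:
  assumes distinct: "\<forall>p\<in>U. inj (\<lambda>a. ev a p)" and "\<omega> \<in> Sigma0 F U \<phi>" and closed: "closed_form U \<omega>"
  obtains g where "\<And>a. smooth_on U (g a)"
    "\<And>p vs. p \<in> U \<Longrightarrow> \<omega> p vs = (\<Sum>a\<in>UNIV. g a p * diag_form a p vs)"
proof -
  let ?W = "\<lambda>a b. phiV F \<phi> a \<and>\<^sub>f phiH \<phi> b"
  let ?gen = "\<lambda>a b p vs. 1/2 * (?W a b p vs + ?W b a p vs)"
  obtain T c where T: "finite T" "T \<subseteq> {?gen a b | a b. True}" "\<forall>\<tau>\<in>T. smooth_on U (c \<tau>)"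
    and \<omega>: "\<forall>p\<in>U. \<forall>vs. \<omega> p vs = (\<Sum>\<tau>\<in>T. c \<tau> p * \<tau> p vs)"
    using assms(2) unfolding Sigma0_def Sp_def by blast
  have "\<exists>ab. \<tau> = ?gen (fst ab) (snd ab)" if "\<tau> \<in> T" for \<tau>
  proof -
    from subsetD[OF T(2) that] obtain a b where "\<tau> = ?gen a b" by blast
    then show ?thesis by (intro exI[of _ "(a, b)"]) simp
  qed
  then have "\<exists>h. \<forall>\<tau>\<in>T. \<tau> = ?gen (fst (h \<tau>)) (snd (h \<tau>))"
    by (intro bchoice) blast
  then obtain h where h: "\<forall>\<tau>\<in>T. \<tau> = ?gen (fst (h \<tau>)) (snd (h \<tau>))" ..
  define \<alpha> where "\<alpha> \<tau> = fst (h \<tau>)" for \<tau>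
  define \<beta> where "\<beta> \<tau> = snd (h \<tau>)" for \<tau>
  have gen: "\<tau> p vs = ?gen (\<alpha> \<tau>) (\<beta> \<tau>) p vs" if "\<tau> \<in> T" for \<tau> p vs
    unfolding \<alpha>_def \<beta>_def by (rule fun_cong[OF fun_cong[OF bspec[OF h that]]])
  \<comment> \<open>The constant components of the generators, symmetric in the two indices.\<close>
  define s :: "'n evol form \<Rightarrow> 'n \<Rightarrow> 'n \<Rightarrow> real" where
    "s \<tau> e f = 1/2 * ((if \<alpha> \<tau> = e \<and> \<beta> \<tau> = f then 1 else 0) + (if \<beta> \<tau> = e \<and> \<alpha> \<tau> = f then 1 else 0))" for \<tau> e f
  have smW: "smooth_form U (?W a b)" for a b
    by (intro smooth_form_wedge U smooth_form_phiV smooth_form_phiH)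
  have expand: "\<tau> p vs = (\<Sum>e\<in>UNIV. \<Sum>f\<in>UNIV. s \<tau> e f * ?W e f p vs)" if "\<tau> \<in> T" for \<tau> p vs
  proof -
    have delta: "(\<Sum>e\<in>UNIV. \<Sum>f\<in>UNIV. (if a = e \<and> b = f then 1 else 0) * ?W e f p vs) = ?W a b p vs" for a b
    proof -
      have "(\<Sum>f\<in>UNIV. (if a = e \<and> b = f then 1 else 0) * ?W e f p vs)
          = (\<Sum>f\<in>UNIV. if b = f then (if a = e then ?W e f p vs else 0) else 0)" for e
        by (intro sum.cong refl) auto
      then show ?thesis by simp
    qed
    have s: "s \<tau> e f * ?W e f p vs = 1/2 * ((if \<alpha> \<tau> = e \<and> \<beta> \<tau> = f then 1 else 0) * ?W e f p vs)
        + 1/2 * ((if \<beta> \<tau> = e \<and> \<alpha> \<tau> = f then 1 else 0) * ?W e f p vs)" for e f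
      by (simp only: s_def distrib_left distrib_right mult.assoc)
    show ?thesis
      by (simp only: s sum.distrib sum_distrib_left[symmetric] delta gen[OF that] distrib_left)
  qed
  have sm: "smooth_form U \<tau>" if "\<tau> \<in> T" for \<tau>
    unfolding smooth_form_def
  proof
    have "smooth_on U (\<lambda>p. ?W a b p vs)" for a b vs using smW by (simp add: smooth_form_def)
    then show "smooth_on U (\<lambda>p. \<tau> p vs)" for vs
      by (simp only: gen[OF that]) (intro smooth_on_mult smooth_on_add smooth_on_const U)
  qed
  \<comment> \<open>The off-diagonal components of the form vanish; this is where closedness is used.\<close>
  have off: "(\<Sum>\<tau>\<in>T. c \<tau> p * s \<tau> e f) = 0" if p: "p \<in> U" and "e \<noteq> f" for p e f
  proof -
    let ?vs = "[sode F p, horiz p e, horiz p f]"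
    have df: "differentiable_form p \<tau>" "c \<tau> differentiable at p" if "\<tau> \<in> T" for \<tau>
      using smooth_form_differentiable[OF sm[OF that] p] smooth_on_differentiable p T(3) that by blast+
    have d\<tau>: "ext_deriv \<tau> p ?vs = (ev f p - ev e p) * s \<tau> e f" if "\<tau> \<in> T" for \<tau>
    proof -
      have dW: "differentiable_form p (?W a b)" for a b using smooth_form_differentiable[OF smW p] .
      have "ext_deriv \<tau> p ?vs = ext_deriv (\<lambda>p vs. 1/2 * ?W (\<alpha> \<tau>) (\<beta> \<tau>) p vs + 1/2 * ?W (\<beta> \<tau>) (\<alpha> \<tau>) p vs) p ?vs"
        by (rule arg_cong[where f = "\<lambda>\<eta>. ext_deriv \<eta> p ?vs"]) (simp only: fun_eq_iff gen[OF that] distrib_left simp_thms)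
      also have "\<dots> = 1/2 * ext_deriv (?W (\<alpha> \<tau>) (\<beta> \<tau>)) p ?vs + 1/2 * ext_deriv (?W (\<beta> \<tau>) (\<alpha> \<tau>)) p ?vs"
        by (rule ext_deriv_lincomb2[OF dW dW])
      also have "\<dots> = (ev f p - ev e p) * s \<tau> e f"
        unfolding ext_deriv_phiV_wedge_phiH[OF p] s_def using \<open>e \<noteq> f\<close> by auto
      finally show ?thesis .
    qed
    have zero: "\<tau> p [sode F p, horiz p a] = 0" "\<tau> p [horiz p a, horiz p b] = 0" if "\<tau> \<in> T" for \<tau> a b
      by (simp_all add: gen[OF that] wedge_eval[OF p])
    have "0 = ext_deriv \<omega> p ?vs" using closed p by (simp add: closed_form_def)
    also have "\<dots> = ext_deriv (\<lambda>p vs. \<Sum>\<tau>\<in>T. c \<tau> p * \<tau> p vs) p ?vs"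
      by (rule fun_cong[OF ext_deriv_local[OF U p]]) (use \<omega> in \<open>simp add: fun_eq_iff\<close>)
    also have "\<dots> = (\<Sum>\<tau>\<in>T. c \<tau> p * ((ev f p - ev e p) * s \<tau> e f))"
      by (subst ext_deriv_fun_lincomb) (auto simp: df one_form_wedge_triple zero d\<tau> intro!: sum.cong)
    also have "\<dots> = (ev f p - ev e p) * (\<Sum>\<tau>\<in>T. c \<tau> p * s \<tau> e f)"
      by (simp add: sum_distrib_left mult_ac)
    finally show ?thesis using distinct p \<open>e \<noteq> f\<close> by (auto dest: injD)
  qed
  show ?thesis
  proof
    show "smooth_on U (\<lambda>p. \<Sum>\<tau>\<in>T. c \<tau> p * s \<tau> a a)" for a
      by (intro smooth_on_sum smooth_on_mult smooth_on_const U) (use T(3) in blast)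
    show "\<omega> p vs = (\<Sum>a\<in>UNIV. (\<Sum>\<tau>\<in>T. c \<tau> p * s \<tau> a a) * diag_form a p vs)" if p: "p \<in> U" for p vs
    proof -
      have "\<omega> p vs = (\<Sum>\<tau>\<in>T. c \<tau> p * (\<Sum>e\<in>UNIV. \<Sum>f\<in>UNIV. s \<tau> e f * ?W e f p vs))"
        using \<omega> p expand by (auto intro!: sum.cong)
      also have "\<dots> = (\<Sum>e\<in>UNIV. \<Sum>f\<in>UNIV. (\<Sum>\<tau>\<in>T. c \<tau> p * s \<tau> e f) * ?W e f p vs)"
        unfolding sum_distrib_left sum_distrib_right
        by (subst sum.swap, rule sum.cong[OF refl], subst sum.swap) (simp add: mult_ac)
      also have "\<dots> = (\<Sum>e\<in>UNIV. \<Sum>f\<in>UNIV. if e = f then (\<Sum>\<tau>\<in>T. c \<tau> p * s \<tau> e e) * ?W e e p vs else 0)"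
        by (intro sum.cong refl) (auto simp: off[OF p])
      finally show ?thesis by (simp add: diag_form_def)
    qed
  qed
qed

section \<open>Coordinates of diagonal forms and the rank of the sequence\<close>

lemma diag_form_eval:
  "p \<in> U \<Longrightarrow> diag_form a p [vert p b, horiz p b] = (if a = b then 1 else 0)"
  by (simp add: diag_form_def wedge_eval)

lemma inj_diag_form: "U \<noteq> {} \<Longrightarrow> inj diag_form"
  using diag_form_eval by (metis (full_types) all_not_in_conv injI zero_neq_one)

text \<open>
  Evaluation on the pairs \<open>(X\<^sub>a\<^sup>V, X\<^sub>a\<^sup>H)\<close> reads off the coefficients of a combination of the \<open>\<omega>\<^sup>a\<close>.  It
  identifies the fibres of the modules \<open>Sig i\<close> with subspaces of \<open>\<real>\<^sup>n\<close>, whose dimensions can be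
  compared.
\<close>

definition coords :: "'n evol \<Rightarrow> 'n evol form \<Rightarrow> real ^ 'n" where
  "coords p \<omega> = (\<chi> a. \<omega> p [vert p a, horiz p a])"

lemma coords_lincomb:
  "coords p (\<lambda>y vs. \<Sum>i\<in>I. c i * \<omega> i y vs) = (\<Sum>i\<in>I. c i *\<^sub>R coords p (\<omega> i))"
  by (simp add: coords_def vec_eq_iff)

lemma coords_diag:
  assumes "p \<in> U" "\<And>vs. \<omega> p vs = (\<Sum>a\<in>UNIV. g a * diag_form a p vs)"
  shows "coords p \<omega> $ a = g a"
  by (simp add: coords_def assms diag_form_eval if_distrib[of "\<lambda>x. _ * x"] cong: if_cong)

lemma coords_diag_form: "p \<in> U \<Longrightarrow> coords p (diag_form a) = axis a 1"
  by (simp add: coords_def vec_eq_iff diag_form_eval axis_def)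

abbreviation Sig :: "nat \<Rightarrow> 'n evol form set" where "Sig \<equiv> Sigma_tilde F U \<phi>"

text \<open>
  The indexing starts at 1, so \<open>Sig (Suc i)\<close> is used throughout to keep away from the index 0.
\<close>

lemma Sig_1: "Sig (Suc 0) = Sp U (range diag_form)"
proof -
  have "diag_form = (\<lambda>a. phiV F \<phi> a \<and>\<^sub>f phiH \<phi> a)" by (simp add: fun_eq_iff diag_form_def)
  then show ?thesis by (simp add: Sigma_tilde_def)
qed

lemma Sig_Suc: "Sig (Suc (Suc i)) = {\<omega> \<in> Sig (Suc i). ext_deriv \<omega> \<in> ideal_gen U (Sig (Suc i))}"
  by (simp add: Sigma_tilde_def)

lemma Sig_subset_1: "Sig (Suc i) \<subseteq> Sig (Suc 0)"
  by (induction i) (auto simp: Sig_Suc)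

lemma Sig_expand:
  assumes "U \<noteq> {}" "\<omega> \<in> Sig (Suc i)" "p \<in> U"
  shows "\<omega> p vs = (\<Sum>a\<in>UNIV. coords p \<omega> $ a * diag_form a p vs)"
proof -
  have "\<omega> \<in> Sp U (range diag_form)" using assms(2) Sig_subset_1 Sig_1 by blast
  then obtain g where "\<forall>p\<in>U. \<forall>vs. \<omega> p vs = (\<Sum>a\<in>UNIV. g a p * diag_form a p vs)"
    unfolding Sp_range[OF inj_diag_form[OF assms(1)]] by blast
  then show ?thesis using coords_diag[OF assms(3), of \<omega> "\<lambda>a. g a p"] assms(3) by simp
qed

lemma closed_in_Sig: "\<omega> \<in> Sig (Suc 0) \<Longrightarrow> closed_form U \<omega> \<Longrightarrow> \<omega> \<in> Sig (Suc i)"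
  by (induction i) (auto simp: Sig_Suc closed_form_def intro!: ideal_genI[OF U, of "{}"])

text \<open>
  Substituting \<open>d\<phi>\<^sup>V = \<alpha> \<and> \<phi>\<^sup>V + \<beta> \<and> \<phi>\<^sup>H\<close> and \<open>d\<phi>\<^sup>H = \<alpha>' \<and> \<phi>\<^sup>V + \<beta>' \<and> \<phi>\<^sup>H\<close> into
  \<open>d\<omega>\<^sup>a = d\<phi>\<^sup>V \<and> \<phi>\<^sup>H - \<phi>\<^sup>V \<and> d\<phi>\<^sup>H\<close>, the terms with \<open>\<beta>\<close> and \<open>\<alpha>'\<close> contain a repeated one-form; what is left
  is a multiple of \<open>\<phi>\<^sup>V \<and> \<phi>\<^sup>H\<close>.
\<close>

lemma integrable_ext_deriv:
  assumes "codist_integrable F U \<phi> a"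
  obtains \<gamma> where "\<gamma> \<in> forms U" "\<And>p vs. p \<in> U \<Longrightarrow> ext_deriv (diag_form a) p vs = (\<gamma> \<and>\<^sub>f diag_form a) p vs"
proof -
  let ?V = "phiV F \<phi> a" and ?H = "phiH \<phi> a"
  obtain \<alpha> \<beta> where \<alpha>: "\<alpha> \<in> forms U" "\<beta> \<in> forms U"
    "\<And>p vs. p \<in> U \<Longrightarrow> ext_deriv ?V p vs = (\<alpha> \<and>\<^sub>f ?V) p vs + (\<beta> \<and>\<^sub>f ?H) p vs"
    using ideal_gen_pair[OF U] assms unfolding codist_integrable_def by metis
  obtain \<alpha>' \<beta>' where \<alpha>': "\<alpha>' \<in> forms U" "\<beta>' \<in> forms U"
    "\<And>p vs. p \<in> U \<Longrightarrow> ext_deriv ?H p vs = (\<alpha>' \<and>\<^sub>f ?V) p vs + (\<beta>' \<and>\<^sub>f ?H) p vs"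
    using ideal_gen_pair[OF U] assms unfolding codist_integrable_def by metis
  have VV: "?V \<and>\<^sub>f ?V = (\<lambda>p vs. 0)" and HH: "?H \<and>\<^sub>f ?H = (\<lambda>p vs. 0)"
    by (simp_all add: phiV_def phiH_def one_form_wedge_self)
  have V: "?V \<and>\<^sub>f \<eta> = grade_sign \<eta> \<and>\<^sub>f ?V" for \<eta>
    unfolding phiV_def by (rule one_form_wedge_commute)
  have sV: "grade_sign ?V = (\<lambda>p vs. - ?V p vs)"
    by (simp add: phiV_def grade_sign_one_form)
  have d: "ext_deriv (diag_form a) p vs = ((\<lambda>p vs. \<alpha> p vs - grade_sign \<beta>' p vs) \<and>\<^sub>f diag_form a) p vs"
    if p: "p \<in> U" for p vs
  proof -
    have df: "differentiable_form p ?V" "differentiable_form p ?H"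
      using smooth_form_differentiable p smooth_form_phiV smooth_form_phiH by blast+
    have 1: "(ext_deriv ?V \<and>\<^sub>f ?H) p vs = (\<alpha> \<and>\<^sub>f diag_form a) p vs"
    proof -
      have "(ext_deriv ?V \<and>\<^sub>f ?H) p vs = ((\<lambda>p vs. (\<alpha> \<and>\<^sub>f ?V) p vs + (\<beta> \<and>\<^sub>f ?H) p vs) \<and>\<^sub>f ?H) p vs"
        using \<alpha>(3)[OF p] by (intro fun_cong[OF wedge_local]) (auto simp: fun_eq_iff)
      also have "\<dots> = (\<alpha> \<and>\<^sub>f diag_form a) p vs + (\<beta> \<and>\<^sub>f ?H \<and>\<^sub>f ?H) p vs"
        by (simp only: wedge_add_left wedge_assoc diag_form_def)
      finally show ?thesis by (simp add: HH wedge_zero_right)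
    qed
    have 2: "(?V \<and>\<^sub>f ext_deriv ?H) p vs = (grade_sign \<beta>' \<and>\<^sub>f diag_form a) p vs"
    proof -
      have "(?V \<and>\<^sub>f ext_deriv ?H) p vs = (?V \<and>\<^sub>f (\<lambda>p vs. (\<alpha>' \<and>\<^sub>f ?V) p vs + (\<beta>' \<and>\<^sub>f ?H) p vs)) p vs"
        using \<alpha>'(3)[OF p] by (intro fun_cong[OF wedge_local]) (auto simp: fun_eq_iff)
      also have "\<dots> = ((?V \<and>\<^sub>f \<alpha>') \<and>\<^sub>f ?V) p vs + ((?V \<and>\<^sub>f \<beta>') \<and>\<^sub>f ?H) p vs"
        by (simp only: wedge_add_right wedge_assoc)
      also have "\<dots> = (grade_sign \<alpha>' \<and>\<^sub>f ?V \<and>\<^sub>f ?V) p vs + (grade_sign \<beta>' \<and>\<^sub>f diag_form a) p vs"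
        by (simp only: V[of \<alpha>'] V[of \<beta>'] wedge_assoc diag_form_def)
      finally show ?thesis by (simp add: VV wedge_zero_right)
    qed
    show ?thesis
      using ext_deriv_wedge[OF df, of vs]
      by (simp add: diag_form_def[symmetric] sV wedge_minus_left wedge_diff_left 1 2)
  qed
  show thesis
    by (rule that[OF _ d]) (intro forms_diff forms_grade_sign U \<alpha> \<alpha>')
qed

lemma integrable_in_Sig:
  assumes "U \<noteq> {}" "codist_integrable F U \<phi> a"
  shows "diag_form a \<in> Sig (Suc i)"
proof (induction i)
  case 0
  have "\<exists>g. (\<forall>i. smooth_on U (g i)) \<and> (\<forall>p\<in>U. \<forall>vs. diag_form a p vs = (\<Sum>i\<in>UNIV. g i p * diag_form i p vs))"
    by (intro exI[of _ "\<lambda>i p. if i = a then 1 else 0"])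
      (auto simp: smooth_on_const if_distrib[of "\<lambda>x. x * _"] cong: if_cong)
  then show ?case by (simp add: Sig_1 Sp_range[OF inj_diag_form[OF assms(1)]])
next
  case (Suc i)
  obtain \<gamma> where "\<gamma> \<in> forms U" "\<And>p vs. p \<in> U \<Longrightarrow> ext_deriv (diag_form a) p vs = (\<gamma> \<and>\<^sub>f diag_form a) p vs"
    using integrable_ext_deriv[OF assms(2)] by blast
  then have "ext_deriv (diag_form a) \<in> ideal_gen U (Sig (Suc i))"
    using Suc by (intro ideal_genI[OF U, of "{()}" "\<lambda>_. diag_form a" _ "\<lambda>_. \<gamma>"]) auto
  then show ?case using Suc by (simp add: Sig_Suc)
qed

text \<open>
  If one coefficient vanishes at \<open>p\<close>, then at \<open>p\<close> the form is a sum of only \<open>n - 1\<close> decomposable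
  two-forms, whose \<open>n\<close>-th power is zero.
\<close>

lemma maximal_rank_coeff_nonzero:
  assumes p: "p \<in> U" and \<omega>: "\<And>vs. \<omega> p vs = (\<Sum>a\<in>UNIV. g a * diag_form a p vs)" and max: "maximal_rank U \<omega>"
  shows "g a \<noteq> 0"
proof
  assume "g a = 0"
  then have "\<omega> p vs = (\<Sum>b\<in>UNIV - {a}. g b * diag_form b p vs)" for vs
    unfolding \<omega> by (intro sum.mono_neutral_right) auto
  then have "\<omega> p = (\<lambda>p vs. \<Sum>b\<in>UNIV - {a}. g b * diag_form b p vs) p"
    by (simp add: fun_eq_iff)
  then have "wedge_power CARD('n) \<omega> p vs
      = wedge_power CARD('n) (\<lambda>p vs. \<Sum>b\<in>UNIV - {a}. g b * diag_form b p vs) p vs" for vs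
    by (intro fun_cong[OF wedge_power_local])
  also have "\<dots> vs = 0" for vs
  proof (rule wedge_power_eq_0)
    show "card (UNIV - {a}) < CARD('n)" by (rule card_Diff1_less) auto
    show "diag_form b \<and>\<^sub>f \<eta> = \<eta> \<and>\<^sub>f diag_form b" for b \<eta>
      unfolding diag_form_def phiV_def phiH_def by (rule one_forms_wedge_central)
    show "diag_form b \<and>\<^sub>f diag_form b = (\<lambda>p vs. 0)" for b
      unfolding diag_form_def phiV_def phiH_def by (rule one_forms_wedge_square)
  qed simp
  finally show False using max p by (auto simp: maximal_rank_def)
qed

text \<open>
  The fibre at \<open>p\<close> of the subbundle consists of the values at \<open>p\<close> of elements of \<open>S\<close>: constant
  combinations of the frame at \<open>p\<close> belong to the fibres everywhere, hence to \<open>S\<close>.  In coordinates the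
  fibre is a subspace of dimension \<open>r\<close>, and membership in \<open>S\<close> can be tested fibre by fibre.
\<close>

lemma sections_fibre:
  assumes ne: "U \<noteq> {}" and sec: "sections_of_subbundle U r S" and S: "S \<subseteq> Sig (Suc 0)" and p: "p \<in> U"
  shows "subspace (coords p ` S)" "dim (coords p ` S) = r"
    and "\<And>\<omega>. \<omega> \<in> forms U \<Longrightarrow> (\<And>y. y \<in> U \<Longrightarrow> \<exists>\<sigma>\<in>S. \<omega> y = \<sigma> y) \<Longrightarrow> \<omega> \<in> S"
proof -
  obtain W where frames: "\<forall>p\<in>U. \<exists>N e. open N \<and> p \<in> N \<and> N \<subseteq> U \<and> (\<forall>i<r. e i \<in> S) \<and>
        (\<forall>y\<in>N. (\<forall>c :: nat \<Rightarrow> real. (\<forall>vs. (\<Sum>i<r. c i * e i y vs) = 0) \<longrightarrow> (\<forall>i<r. c i = 0)) \<and>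
                W y = {(\<lambda>vs. \<Sum>i<r. c i * e i y vs) | c. True})"
    and S_eq: "S = {\<omega> \<in> forms U. \<forall>p\<in>U. \<omega> p \<in> W p}"
    using sec unfolding sections_of_subbundle_def by (elim exE conjE)
  show sec': "\<omega> \<in> S" if "\<omega> \<in> forms U" "\<And>y. y \<in> U \<Longrightarrow> \<exists>\<sigma>\<in>S. \<omega> y = \<sigma> y" for \<omega>
  proof -
    have "\<omega> y \<in> W y" if "y \<in> U" for y
      using \<open>\<And>y. y \<in> U \<Longrightarrow> \<exists>\<sigma>\<in>S. \<omega> y = \<sigma> y\<close>[OF that] that S_eq by auto
    then show ?thesis using that S_eq by auto
  qed
  have frame: "\<exists>e. (\<forall>i<r. e i \<in> S) \<and> (\<forall>c :: nat \<Rightarrow> real. (\<forall>vs. (\<Sum>i<r. c i * e i y vs) = 0) \<longrightarrow> (\<forall>i<r. c i = 0))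
      \<and> W y = {(\<lambda>vs. \<Sum>i<r. c i * e i y vs) | c. True}" if y: "y \<in> U" for y
  proof -
    obtain N e where "y \<in> N" "\<forall>i<r. e i \<in> S"
      and *: "\<forall>y\<in>N. (\<forall>c :: nat \<Rightarrow> real. (\<forall>vs. (\<Sum>i<r. c i * e i y vs) = 0) \<longrightarrow> (\<forall>i<r. c i = 0)) \<and>
                W y = {(\<lambda>vs. \<Sum>i<r. c i * e i y vs) | c. True}"
      using bspec[OF frames y] by (elim exE conjE)
    then show ?thesis using bspec[OF * \<open>y \<in> N\<close>] by (intro exI[of _ e]) simp
  qed
  \<comment> \<open>The fibres are linear subspaces, although the frame varies from point to point.\<close>
  have W_lincomb: "(\<lambda>vs. \<Sum>j<r. c j * m j vs) \<in> W y" if y: "y \<in> U" and m: "\<And>j. j < r \<Longrightarrow> m j \<in> W y" for y c m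
  proof -
    obtain e where W: "W y = {(\<lambda>vs. \<Sum>i<r. c i * e i y vs) | c. True}" using frame[OF y] by blast
    have "\<forall>j. \<exists>k. j < r \<longrightarrow> m j = (\<lambda>vs. \<Sum>i<r. k i * e i y vs)" using m W by blast
    then obtain k where k: "\<And>j. j < r \<Longrightarrow> m j = (\<lambda>vs. \<Sum>i<r. k j i * e i y vs)" by metis
    have "(\<lambda>vs. \<Sum>j<r. c j * m j vs) = (\<lambda>vs. \<Sum>i<r. (\<Sum>j<r. c j * k j i) * e i y vs)"
    proof
      fix vs
      have "(\<Sum>j<r. c j * m j vs) = (\<Sum>j<r. \<Sum>i<r. c j * k j i * e i y vs)"
        by (intro sum.cong refl) (simp add: k sum_distrib_left mult.assoc)
      also have "\<dots> = (\<Sum>i<r. (\<Sum>j<r. c j * k j i) * e i y vs)"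
        by (subst sum.swap) (simp add: sum_distrib_right)
      finally show "(\<Sum>j<r. c j * m j vs) = (\<Sum>i<r. (\<Sum>j<r. c j * k j i) * e i y vs)" .
    qed
    then show ?thesis
      unfolding W by (intro CollectI exI[of _ "\<lambda>i. \<Sum>j<r. c j * k j i"] conjI TrueI)
  qed
  obtain e where e: "\<forall>i<r. e i \<in> S"
    and indep: "\<forall>c :: nat \<Rightarrow> real. (\<forall>vs. (\<Sum>i<r. c i * e i p vs) = 0) \<longrightarrow> (\<forall>i<r. c i = 0)"
    and W: "W p = {(\<lambda>vs. \<Sum>i<r. c i * e i p vs) | c. True}"
    using frame[OF p] by (elim exE conjE)
  let ?b = "\<lambda>i. coords p (e i)"
  have comb: "(\<lambda>y vs. \<Sum>i<r. c i * e i y vs) \<in> S" for c :: "nat \<Rightarrow> real"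
  proof -
    have "(\<lambda>y vs. \<Sum>i<r. c i * e i y vs) \<in> forms U"
      by (rule forms_lincomb[OF U]) (use e S_eq smooth_on_const in auto)
    moreover have "(\<lambda>vs. \<Sum>i<r. c i * e i y vs) \<in> W y" if "y \<in> U" for y
      by (rule W_lincomb[OF that]) (use e S_eq that in auto)
    ultimately show ?thesis using S_eq by auto
  qed
  have span: "coords p ` S = span (?b ` {..<r})"
  proof
    show "coords p ` S \<subseteq> span (?b ` {..<r})"
    proof
      fix x assume "x \<in> coords p ` S"
      then obtain \<omega> where \<omega>: "\<omega> \<in> S" "x = coords p \<omega>" by blast
      then have "\<omega> p \<in> W p" using S_eq p by auto
      then obtain c where c: "\<omega> p = (\<lambda>vs. \<Sum>i<r. c i * e i p vs)" using W by blast
      then have "coords p \<omega> = coords p (\<lambda>y vs. \<Sum>i<r. c i * e i y vs)" by (simp add: coords_def)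
      then have "x = (\<Sum>i<r. c i *\<^sub>R ?b i)" using \<omega> by (simp add: coords_lincomb)
      then show "x \<in> span (?b ` {..<r})"
        by (simp only:) (intro span_sum span_scale span_base imageI)
    qed
    show "span (?b ` {..<r}) \<subseteq> coords p ` S"
    proof -
      let ?T = "range (\<lambda>c. \<Sum>i<r. c i *\<^sub>R ?b i)"
      have "subspace ?T"
      proof (rule subspaceI)
        show "0 \<in> ?T" by (rule range_eqI[of _ _ "\<lambda>_. 0"]) simp
        show "x + y \<in> ?T" if xy: "x \<in> ?T" "y \<in> ?T" for x y
        proof -
          obtain c c' where "x = (\<Sum>i<r. c i *\<^sub>R ?b i)" "y = (\<Sum>i<r. c' i *\<^sub>R ?b i)"
            using xy by (elim rangeE)
          then show ?thesis
            by (intro range_eqI[of _ _ "\<lambda>i. c i + c' i"]) (simp add: scaleR_add_left sum.distrib)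
        qed
        show "k *\<^sub>R x \<in> ?T" if x: "x \<in> ?T" for k x
        proof -
          obtain c where "x = (\<Sum>i<r. c i *\<^sub>R ?b i)" using x by (elim rangeE)
          then show ?thesis
            by (intro range_eqI[of _ _ "\<lambda>i. k * c i"]) (simp add: scaleR_sum_right)
        qed
      qed
      moreover have "?b ` {..<r} \<subseteq> ?T"
      proof (intro image_subsetI)
        fix i assume i: "i \<in> {..<r}"
        have "(\<Sum>j<r. (if j = i then 1 else 0) *\<^sub>R ?b j) = (\<Sum>j<r. if j = i then ?b j else 0)"
          by (intro sum.cong) auto
        then show "?b i \<in> ?T" using i by (intro range_eqI[of _ _ "\<lambda>j. if j = i then 1 else 0"]) simp
      qed
      ultimately have "span (?b ` {..<r}) \<subseteq> ?T" by (simp add: span_minimal)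
      also have "?T \<subseteq> coords p ` S"
        using comb coords_lincomb[of p _ e "{..<r}", symmetric] by (intro image_subsetI) auto
      finally show ?thesis .
    qed
  qed
  show "subspace (coords p ` S)" by (simp add: span)
  show "dim (coords p ` S) = r"
    unfolding span
  proof (rule dim_span_family)
    fix c i assume 0: "(\<Sum>i<r. c i *\<^sub>R ?b i) = 0" and i: "i < r"
    let ?\<omega> = "\<lambda>y vs. \<Sum>i<r. c i * e i y vs"
    have "coords p ?\<omega> = 0" using 0 by (simp add: coords_lincomb)
    moreover have "?\<omega> \<in> Sig (Suc 0)" using comb S by blast
    ultimately have "?\<omega> p vs = 0" for vs
      using Sig_expand[OF ne _ p, of ?\<omega> 0 vs] by simp
    then show "c i = 0" using indep i by blast
  qed
qed

text \<open>
  Inclusion of modules gives inclusion of fibres; equal ranks make the fibres equal, and the fibres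
  determine the module.
\<close>

lemma sections_rank_mono:
  assumes ne: "U \<noteq> {}"
    and sec: "sections_of_subbundle U r S" "sections_of_subbundle U r' S'"
    and S: "S \<subseteq> Sig (Suc 0)" and sub: "S' \<subseteq> S"
  shows "r' \<le> r" and "r \<le> r' \<Longrightarrow> S' = S"
proof -
  have S': "S' \<subseteq> Sig (Suc 0)" using S sub by blast
  note fib = sections_fibre[OF ne sec(1) S] and fib' = sections_fibre[OF ne sec(2) S']
  have inc: "coords p ` S' \<subseteq> coords p ` S" for p using sub by blast
  obtain q where "q \<in> U" using ne by blast
  then show "r' \<le> r" using dim_subset[OF inc, of q] fib(2) fib'(2) by simp
  show "S' = S" if "r \<le> r'"
  proof
    show "S \<subseteq> S'"
    proof
      fix \<omega> assume \<omega>: "\<omega> \<in> S"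
      have "\<omega> \<in> forms U" using \<omega> sec(1) by (auto simp: sections_of_subbundle_def)
      moreover have "\<exists>\<sigma>\<in>S'. \<omega> y = \<sigma> y" if y: "y \<in> U" for y
      proof -
        have "coords y ` S' = coords y ` S"
          using \<open>r \<le> r'\<close> inc by (intro subspace_dim_equal fib(1) fib'(1) y) (simp_all add: fib(2) fib'(2) y)
        then obtain \<sigma> where \<sigma>: "\<sigma> \<in> S'" "coords y \<omega> = coords y \<sigma>" using \<omega> by blast
        have "\<omega> y = \<sigma> y"
        proof
          fix vs
          have "\<omega> \<in> Sig (Suc 0)" "\<sigma> \<in> Sig (Suc 0)" using \<sigma>(1) \<omega> S S' by blast+
          from this[THEN Sig_expand[OF ne _ y]] show "\<omega> y vs = \<sigma> y vs" by (simp only: \<sigma>(2))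
        qed
        then show ?thesis using \<sigma>(1) by blast
      qed
      ultimately show "\<omega> \<in> S'" using fib'(3) \<open>q \<in> U\<close> by blast
    qed
  qed (rule sub)
qed

end

theorem theorem3p12:
  fixes F :: "'n::finite evol \<Rightarrow> real ^ 'n"
    and U :: "'n evol set"
    and X \<phi> :: "'n \<Rightarrow> 'n evol \<Rightarrow> real ^ 'n"
    and ev :: "'n \<Rightarrow> 'n evol \<Rightarrow> real"
    and q :: nat
  assumes "open U"
    and "smooth_on U F"
    and "eigenframe F U X ev"
    and "\<forall>p\<in>U. inj (\<lambda>a. ev a p)"
    and "dual_frame U X \<phi>"
    and "\<forall>i\<ge>1. \<exists>r. sections_of_subbundle U r (Sigma_tilde F U \<phi> i)"
    and "q \<ge> 1"
    and "card {a. \<not> codist_integrable F U \<phi> a} = q"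
    and "\<forall>i\<in>{1..q}. \<not> differential_ideal (ideal_gen U (Sigma_tilde F U \<phi> i))"
  shows "\<not> (\<exists>\<omega>\<in>Sigma0 F U \<phi>. closed_form U \<omega> \<and> maximal_rank U \<omega>)"
proof
  interpret eigen_sode F U X \<phi> ev
    using assms(1-3,5) by unfold_locales
  assume "\<exists>\<omega>\<in>Sigma0 F U \<phi>. closed_form U \<omega> \<and> maximal_rank U \<omega>"
  then obtain \<omega> where \<omega>: "\<omega> \<in> Sigma0 F U \<phi>" "closed_form U \<omega>" "maximal_rank U \<omega>" by blast
  \<comment> \<open>On the empty set every ideal contains all forms, so it is differential.\<close>
  have ne: "U \<noteq> {}"
  proof
    assume "U = {}"
    then have "differential_ideal (ideal_gen U (Sig 1))"
      by (auto simp: differential_ideal_def intro!: ideal_genI[of _ "{}"])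
    then show False using assms(7,9) by auto
  qed
  then obtain p where p: "p \<in> U" by blast
  obtain g where g: "\<And>a. smooth_on U (g a)" "\<And>p vs. p \<in> U \<Longrightarrow> \<omega> p vs = (\<Sum>a\<in>UNIV. g a p * diag_form a p vs)"
    using closed_Sigma0_diagonal[OF assms(4) \<omega>(1,2)] by blast
  then have "\<omega> \<in> Sig (Suc 0)" unfolding Sig_1 Sp_range[OF inj_diag_form[OF ne]] by blast
  then have \<omega>_Sig: "\<omega> \<in> Sig (Suc q)" using closed_in_Sig \<omega>(2) by blast
  obtain r where r: "\<And>i. sections_of_subbundle U (r i) (Sig (Suc i))"
  proof -
    have "\<forall>i. \<exists>r. sections_of_subbundle U r (Sig (Suc i))" using assms(6) by simp
    then show thesis using that by metis
  qed
  have drop: "r (Suc i) < r i" if "i < q" for i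
  proof (rule ccontr)
    assume "\<not> r (Suc i) < r i"
    then have eq: "Sig (Suc (Suc i)) = Sig (Suc i)"
      by (intro sections_rank_mono(2)[OF ne r r Sig_subset_1]) (auto simp: Sig_Suc)
    have "differential_ideal (ideal_gen U (Sig (Suc i)))"
    proof (rule differential_ideal_gen[OF assms(1)])
      show "Sig (Suc i) \<subseteq> forms U" using r[of i] by (auto simp: sections_of_subbundle_def)
      show "ext_deriv \<sigma> \<in> ideal_gen U (Sig (Suc i))" if "\<sigma> \<in> Sig (Suc i)" for \<sigma>
        using that eq Sig_Suc[of i] by blast
    qed
    then show False using assms(9) \<open>i < q\<close> by simp
  qed
  have bound: "r i + i \<le> CARD('n)" if "i \<le> q" for i
    using that
  proof (induction i)
    case 0
    have "dim (coords p ` Sig (Suc 0)) \<le> CARD('n)"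
      using dim_subset_UNIV[of "coords p ` Sig (Suc 0)"] by simp
    then show ?case using sections_fibre(2)[OF ne r _ p, of 0] by simp
  next
    case (Suc i)
    then show ?case using drop[of i] by simp
  qed
  define A where "A = {a. codist_integrable F U \<phi> a}"
  have nA: "{a. \<not> codist_integrable F U \<phi> a} = - A" by (auto simp: A_def)
  then have "card (- A) = q" using assms(8) by simp
  moreover have "card A + card (- A) = CARD('n)"
    using card_Un_disjoint[of A "- A"] by simp
  ultimately have cardA: "card A + q = CARD('n)" by simp
  have "- A \<noteq> {}" using \<open>card (- A) = q\<close> assms(7) by auto
  then obtain b where b: "b \<notin> A" by blast
  let ?V = "coords p ` Sig (Suc q)"
  have "Suc (card A) \<le> dim ?V"
  proof (rule dim_ge_axes_and_vector[OF _ _ _ _ b])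
    show "subspace ?V" by (rule sections_fibre(1)[OF ne r Sig_subset_1 p])
    show "axis a 1 \<in> ?V" if "a \<in> A" for a
      using integrable_in_Sig[OF ne, of a q] that coords_diag_form[OF p, of a] by (force simp: A_def)
    show "coords p \<omega> \<in> ?V" using \<omega>_Sig by blast
    have "g b p \<noteq> 0" by (rule maximal_rank_coeff_nonzero[where g = "\<lambda>a. g a p", OF p g(2)[OF p] \<omega>(3)])
    then show "coords p \<omega> $ b \<noteq> 0" using coords_diag[where \<omega> = \<omega> and g = "\<lambda>a. g a p", OF p g(2)[OF p]] by simp
  qed
  also have "dim ?V = r q" by (rule sections_fibre(2)[OF ne r Sig_subset_1 p])
  finally show False using bound[of q] cardA by simp
qed

end
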